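(* Assume $f_{\min}:=\inf_{x\in\mathcal{M}}f(x)>0$ and let $\omega_m$ be the volume of the unit ball in $\mathbb{R}^m$. Let $(r_n)_{n\ge1}$ be a sequence of positive numbers with $r_n\to0$ as $n\to\infty$ and $n r_n^m\ge C\log n$ for all $n$, where $C>0$ is a constant. Let $\beta_{k,n}$ be the $k$-th Betti number of $\mathcal{U}(\mathcal{P}_n,r_n)$. 1. If $C>(\omega_m f_{\min})^{-1}$, then $$\lim_{n\to\infty}\mathbb{P}\big(\beta_{k,n}=\beta_k(\mathcal{M})\ \text{ for all } 0\le k\le m\big)=1.$$ 2. If $C>2(\omega_m f_{\min})^{-1}$, then almost surely there exists a (random) $M>0$ such that for every $n>M$, $$\beta_{k,n}=\beta_k(\mathcal{M})\quad\text{for all }0\le k\le m.$$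
   Context: $\mathcal{M}\subset\mathbb{R}^d$ is a closed (compact, without boundary) smooth embedded $m$-dimensional manifold, $m<d$. $f:\mathcal{M}\to\mathbb{R}$ is a bounded measurable probability density with respect to the Riemannian volume form on $\mathcal{M}$. For each $n\ge 1$, $\mathcal{P}_n$ is a spatial Poisson process on $\mathcal{M}$ with intensity function $nf$; for almost-sure statements all $\mathcal{P}_n$ are taken to be defined on a common probability space. For finite $\mathcal{P}\subset\mathbb{R}^d$ and $\epsilon>0$, $\mathcal{U}(\mathcal{P},\epsilon)=\bigcup_{p\in\mathcal{P}}B_\epsilon(p)$, with $B_\epsilon(p)$ the closed $d$-dimensional ball of radius $\epsilon$ centered at $p$. $\beta_k(X)$ is the rank of the $k$-th homology group of $X$, and $\beta_{k,n}=\beta_k(\mathcal{U}(\mathcal{P}_n,r_n))$. *)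

theory Defs
  imports "HOL-Homology.Homology" "HOL-Probability.Probability" "HOL-Library.Extended_Nat"
begin

subsection \<open>Smooth submanifolds of Euclidean space\<close>

text \<open>Differentiability class \<open>C\<^sup>n\<close> on an open set. In finite dimension, asking every
  directional derivative to be of class \<open>C\<^sup>n\<close> is the same as asking this of the total derivative.\<close>

primrec C_on :: "nat \<Rightarrow> 'a::euclidean_space set \<Rightarrow> ('a \<Rightarrow> 'b::real_normed_vector) \<Rightarrow> bool" where
  "C_on 0 U f \<longleftrightarrow> continuous_on U f"
| "C_on (Suc n) U f \<longleftrightarrow> (\<forall>x\<in>U. f differentiable (at x)) \<and>
     (\<forall>v. C_on n U (\<lambda>x. frechet_derivative f (at x) v))"

definition smooth_on :: "'a::euclidean_space set \<Rightarrow> ('a \<Rightarrow> 'b::real_normed_vector) \<Rightarrow> bool" where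
  "smooth_on U f \<longleftrightarrow> (\<forall>n. C_on n U f)"

text \<open>A slice chart is a diffeomorphism \<open>\<phi>\<close> (with inverse \<open>\<psi>\<close>) between open sets that
  straightens \<open>M\<close> to the coordinate subspace spanned by a set \<open>B\<close> of \<open>m\<close> standard basis vectors;
  \<open>span B\<close> plays the role of \<open>\<real>\<^sup>m\<close>, which lets \<open>m\<close> be a number (possibly \<open>0\<close>) and not a type.\<close>

definition slice_chart ::
  "nat \<Rightarrow> 'a::euclidean_space set \<Rightarrow> 'a set \<Rightarrow> 'a set \<Rightarrow> ('a \<Rightarrow> 'a) \<Rightarrow> ('a \<Rightarrow> 'a) \<Rightarrow> 'a set \<Rightarrow> bool"
where
  "slice_chart m M U V \<phi> \<psi> B \<longleftrightarrow>
     open U \<and> open V \<and> homeomorphism U V \<phi> \<psi> \<and> smooth_on U \<phi> \<and> smooth_on V \<psi> \<and>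
     B \<subseteq> Basis \<and> card B = m \<and> \<phi> ` (M \<inter> U) = V \<inter> span B"

definition smooth_submanifold :: "nat \<Rightarrow> 'a::euclidean_space set \<Rightarrow> bool" where
  "smooth_submanifold m M \<longleftrightarrow> (\<forall>p\<in>M. \<exists>U V \<phi> \<psi> B. p \<in> U \<and> slice_chart m M U V \<phi> \<psi> B)"

subsection \<open>Riemannian volume\<close>

text \<open>Lebesgue measure of the coordinate subspace \<open>span B\<close>, seen as a Borel measure on the ambient
  space; compare the definition of \<^const>\<open>lborel\<close>, which is the case \<open>B = Basis\<close>.\<close>

definition lborel_span :: "'a::euclidean_space set \<Rightarrow> 'a measure" where
  "lborel_span B = distr (\<Pi>\<^sub>M b\<in>B. lborel) borel (\<lambda>x. \<Sum>b\<in>B. x b *\<^sub>R b)"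

text \<open>The determinant of the matrix with entries \<open>L b \<bullet> L c\<close> for \<open>b, c \<in> B\<close>. For \<open>L\<close> the derivative
  of a parametrization this is the determinant of the metric tensor induced by the ambient space.\<close>

definition gram_det :: "'a::euclidean_space set \<Rightarrow> ('a \<Rightarrow> 'a) \<Rightarrow> real" where
  "gram_det B L = (\<Sum>p | p permutes B. of_int (sign p) * (\<Prod>b\<in>B. L b \<bullet> L (p b)))"

text \<open>The Riemannian volume of a submanifold \<open>M\<close> (with the metric induced by the ambient space) is the
  unique Borel measure on \<open>M\<close> which has density \<open>sqrt (det g)\<close> in every local parametrization.\<close>

definition riemannian_volume :: "nat \<Rightarrow> 'a::euclidean_space set \<Rightarrow> 'a measure \<Rightarrow> bool" where
  "riemannian_volume m M \<mu> \<longleftrightarrow>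
     space \<mu> = M \<and> sets \<mu> = sets (restrict_space borel M) \<and>
     (\<forall>U V \<phi> \<psi> B. slice_chart m M U V \<phi> \<psi> B \<longrightarrow>
        (\<forall>A\<in>sets \<mu>. A \<subseteq> U \<longrightarrow>
           emeasure \<mu> A =
             (\<integral>\<^sup>+y\<in>V \<inter> \<psi> -` A. ennreal (sqrt (gram_det B (frechet_derivative \<psi> (at y)))) \<partial>lborel_span B)))"

subsection \<open>Poisson processes\<close>

text \<open>A configuration of points is a finite multiset: repeated points have probability zero when the
  intensity measure \<open>\<mu>\<close> has no atoms, but not in general (for instance on a manifold of dimension 0).
  \<open>points_in A N\<close> is the number of points of the configuration \<open>N\<close> that lie in \<open>A\<close>. For a point
  process, every such number is Poisson distributed with mean \<open>\<mu> A\<close> (where \<open>0 ^ 0 = 1\<close>), and the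
  numbers for disjoint sets are independent.\<close>

definition points_in :: "'a set \<Rightarrow> 'a multiset \<Rightarrow> nat" where
  "points_in A N = size (filter_mset (\<lambda>x. x \<in> A) N)"

definition poisson_process :: "'w measure \<Rightarrow> 'a measure \<Rightarrow> ('w \<Rightarrow> 'a multiset) \<Rightarrow> bool" where
  "poisson_process \<Omega> \<mu> N \<longleftrightarrow>
     finite_measure \<mu> \<and>
     (\<forall>w\<in>space \<Omega>. set_mset (N w) \<subseteq> space \<mu>) \<and>
     (\<forall>A\<in>sets \<mu>. (\<lambda>w. points_in A (N w)) \<in> measurable \<Omega> (count_space UNIV)) \<and>
     (\<forall>A\<in>sets \<mu>. \<forall>j. measure \<Omega> {w \<in> space \<Omega>. points_in A (N w) = j} =
        measure \<mu> A ^ j / fact j * exp (- measure \<mu> A)) \<and>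
     (\<forall>l (A :: nat \<Rightarrow> 'a set). (\<forall>i<l. A i \<in> sets \<mu>) \<and> disjoint_family_on A {..<l} \<longrightarrow>
        prob_space.indep_vars \<Omega> (\<lambda>_. count_space UNIV) (\<lambda>i w. points_in (A i) (N w)) {..<l})"

subsection \<open>Betti numbers\<close>

text \<open>The rank of a commutative group: the supremum of the sizes of its finite subsets that are
  linearly independent over the integers.\<close>

definition int_independent :: "('g, 'x) monoid_scheme \<Rightarrow> 'g set \<Rightarrow> bool" where
  "int_independent G S \<longleftrightarrow> finite S \<and> S \<subseteq> carrier G \<and>
     (\<forall>c :: 'g \<Rightarrow> int. finprod G (\<lambda>x. x [^]\<^bsub>G\<^esub> c x) S = \<one>\<^bsub>G\<^esub> \<longrightarrow> (\<forall>x\<in>S. c x = 0))"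

definition group_rank :: "('g, 'x) monoid_scheme \<Rightarrow> enat" where
  "group_rank G = (SUP S\<in>{S. int_independent G S}. enat (card S))"

definition betti :: "nat \<Rightarrow> 'a::topological_space set \<Rightarrow> enat" where
  "betti k X = group_rank (homology_group (int k) (top_of_set X))"

definition ball_union :: "'a::metric_space set \<Rightarrow> real \<Rightarrow> 'a set" where
  "ball_union P \<epsilon> = (\<Union>p\<in>P. cball p \<epsilon>)"

end

theory Submission
  imports Defs
begin

text \<open>Two geometric facts reduce the theorem to counting points. Since \<open>M\<close> has positive reach, the
  nearest point projection \<open>\<pi>\<close> is Lipschitz near \<open>M\<close>; and if the balls of radius \<open>(1 - \<eta>) r\<close> around
  points of \<open>M\<close> already cover \<open>M\<close>, then for small \<open>r\<close> the whole segment from \<open>x\<close> to \<open>\<pi> x\<close> stays in the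
  union of the balls of radius \<open>r\<close>: far from \<open>M\<close> it stays in the ball that contains \<open>x\<close>, and within
  \<open>\<eta> r\<close> of \<open>M\<close> it lies in the ball that covers \<open>\<pi> x\<close>. So the union deformation retracts onto \<open>M\<close>. A ball
  of radius \<open>s\<close> around a point of \<open>M\<close> has volume at least \<open>(1 - o(1)) \<omega>\<^sub>m s\<^sup>m\<close> uniformly, so a union bound
  over a net of mesh \<open>\<eta> r\<close> bounds the probability that the cover fails by \<open>O(n\<^bsup>1 - a\<^esup>)\<close> with
  \<open>a\<close> as close as desired to \<open>C \<omega>\<^sub>m fmin\<close>. This tends to \<open>0\<close> if \<open>a > 1\<close>, and is summable if \<open>a > 2\<close>.

  The first limit also requires the event itself to be measurable (a non-measurable set would have
  measure \<open>0\<close>). By the nerve theorem the Betti numbers depend only on the nerve of the balls, of which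
  there are countably many, and each nerve is a Borel condition on the configuration.\<close>

subsection \<open>Betti numbers and homotopy\<close>

text \<open>To reach these thresholds for \<open>C\<close>, almost nothing may be lost in the
  radius: requiring balls of radius \<open>r / 2\<close> to cover \<open>M\<close> would already
  cost a factor of 2 to the power \<open>m\<close>. The strict inequality on \<open>C\<close> leaves
  room for one small \<eta>, which pays for the deviation of charts from isometries, for the mesh of
  the net and for the gap between \<open>(1 - \<eta>) * r\<close> and \<open>r\<close>. The
  \<open>1\<close> in the exponent \<open>1 - a\<close> is the price of the net, whose size is at
  most a constant times \<open>n\<close>; summability costs one further power of \<open>n\<close>.

  The obstacle to measurability is that a Poisson process gives access only to counts of points in
  Borel sets, whereas a nerve is a joint condition on the positions of several points. Rounding the
  points to a fine lattice leaves countably many configurations, each described by counts, and the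
  nerve is recovered as the mesh tends to 0.\<close>

lemma iso_int_independent_image:
  assumes G: "comm_group G" and H: "comm_group H" and h: "h \<in> iso G H"
    and S: "int_independent G S"
  shows "int_independent H (h ` S)" "card (h ` S) = card S"
proof -
  interpret G: comm_group G by (rule G)
  interpret H: comm_group H by (rule H)
  have hom: "h \<in> hom G H" and inj: "inj_on h (carrier G)" and im: "h ` carrier G = carrier H"
    using h by (auto simp: iso_def bij_betw_def)
  interpret group_hom G H h
    by unfold_locales (rule hom)
  have fin: "finite S" and SG: "S \<subseteq> carrier G"
    and ind: "\<And>c x. finprod G (\<lambda>x. x [^]\<^bsub>G\<^esub> (c x :: int)) S = \<one>\<^bsub>G\<^esub> \<Longrightarrow> x \<in> S \<Longrightarrow> c x = 0"
    using S by (auto simp: int_independent_def)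
  have injS: "inj_on h S" using inj SG by (rule inj_on_subset)
  show "card (h ` S) = card S" using injS by (rule card_image)
  have hprod: "h (finprod G g A) = finprod H (h \<circ> g) A"
    if "finite A" "g \<in> A \<rightarrow> carrier G" for g A
    using that by (induction A) (auto simp: Pi_iff)
  show "int_independent H (h ` S)"
    unfolding int_independent_def
  proof (intro conjI allI impI ballI)
    show "finite (h ` S)" using fin by simp
    show "h ` S \<subseteq> carrier H" using SG im by auto
    fix c :: "_ \<Rightarrow> int" and y
    assume c: "finprod H (\<lambda>x. x [^]\<^bsub>H\<^esub> c x) (h ` S) = \<one>\<^bsub>H\<^esub>" and y: "y \<in> h ` S"
    then obtain x where x: "x \<in> S" "y = h x" by auto
    let ?g = "\<lambda>x. x [^]\<^bsub>G\<^esub> c (h x)"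
    have gG: "?g \<in> S \<rightarrow> carrier G" using SG by auto
    have "finprod H (\<lambda>x. x [^]\<^bsub>H\<^esub> c x) (h ` S) = finprod H (\<lambda>x. h x [^]\<^bsub>H\<^esub> c (h x)) S"
      using SG im injS by (intro H.finprod_reindex) auto
    also have "\<dots> = finprod H (h \<circ> ?g) S"
      by (rule H.finprod_cong) (use SG im in \<open>auto simp: simp_implies_def hom_int_pow subset_iff\<close>)
    also have "\<dots> = h (finprod G ?g S)"
      by (rule hprod [symmetric, OF fin gG])
    finally have "h (finprod G ?g S) = h \<one>\<^bsub>G\<^esub>" using c by simp
    then have "finprod G ?g S = \<one>\<^bsub>G\<^esub>"
      using inj G.finprod_closed[OF gG] G.one_closed by (metis inj_onD)
    from ind[OF this x(1)] x(2) show "c y = 0" by simp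
  qed
qed

lemma group_rank_iso_le:
  assumes "comm_group G" "comm_group H" "G \<cong> H"
  shows "group_rank G \<le> group_rank H"
proof -
  obtain h where h: "h \<in> iso G H" using assms(3) by (auto simp: is_iso_def)
  show ?thesis
    unfolding group_rank_def
    by (rule SUP_mono) (metis iso_int_independent_image[OF assms(1,2) h] mem_Collect_eq order_refl)
qed

text \<open>Homology enters only through its homotopy invariance. As ranks are suprema in
  \<open>enat\<close>, isomorphic groups have equal ranks whether or not these are finite.\<close>

lemma betti_homotopy_equivalent:
  assumes "top_of_set X homotopy_equivalent_space top_of_set Y"
  shows "betti k X = betti k Y"
  unfolding betti_def
  by (meson abelian_homology_group assms group_rank_iso_le order_antisym
      homotopy_equivalent_space_imp_isomorphic_homology_groups homotopy_equivalent_space_sym)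

text \<open>Each point \<open>x\<close> of \<open>U\<close> is joined to its image by a segment in \<open>U\<close>, so the straight-line homotopy
  makes \<open>p\<close> a deformation retraction.\<close>

lemma segment_retraction_homotopy_equivalent:
  fixes U M :: "'a::real_normed_vector set"
  assumes "continuous_on U p" "p ` U \<subseteq> M" "M \<subseteq> U" "\<And>x. x \<in> M \<Longrightarrow> p x = x"
    and "\<And>x. x \<in> U \<Longrightarrow> closed_segment (p x) x \<subseteq> U"
  shows "top_of_set U homotopy_equivalent_space top_of_set M"
proof (rule deformation_retract_imp_homotopy_equivalent_space)
  show "homotopic_with (\<lambda>x. True) (top_of_set U) (top_of_set U) p id"
    using assms by (intro homotopic_with_linear) (auto simp: continuous_on_id)
  show "retraction_maps (top_of_set U) (top_of_set M) p id"
    using assms by (auto simp: retraction_maps_def continuous_on_id)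
qed

subsection \<open>The nerve theorem for balls\<close>

text \<open>The Cech complex of the closed balls. Its vertices are indices instead of points, so
  repeated points are harmless and, for given \<open>N\<close>, only finitely many complexes can
  occur.\<close>

definition nerve :: "nat \<Rightarrow> (nat \<Rightarrow> 'a::metric_space) \<Rightarrow> real \<Rightarrow> nat set set" where
  "nerve N p r = {I. I \<subseteq> {..<N} \<and> I \<noteq> {} \<and> (\<exists>x. \<forall>i\<in>I. dist (p i) x \<le> r)}"

text \<open>The geometric realization of a complex on the vertices \<open>{..<N}\<close>, as an open cone: the barycentric
  coordinates are not normalized, and the coordinates from \<open>N\<close> on are unconstrained.\<close>

definition realization :: "nat \<Rightarrow> nat set set \<Rightarrow> (nat \<Rightarrow> real) set" where
  "realization N K = {u. (\<forall>i<N. 0 \<le> u i) \<and> {i. i < N \<and> 0 < u i} \<in> K}"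

text \<open>A nerve is closed under passing to nonempty subsets, so it is enough to enclose the
  support of \<open>u\<close> in some face and to exhibit one positive coordinate.\<close>

lemma realizationI:
  assumes "\<And>i. i < N \<Longrightarrow> 0 \<le> u i" "i < N" "0 < u i" "I \<in> nerve N p r"
    and "\<And>i. i < N \<Longrightarrow> 0 < u i \<Longrightarrow> i \<in> I"
  shows "u \<in> realization N (nerve N p r)"
  using assms unfolding realization_def nerve_def by blast

text \<open>The intersections of the balls of radius \<open>r + 1 / (n + 1)\<close> form a
  decreasing sequence of nonempty compact sets, and a point common to all of them is within
  \<open>r\<close> of every center.\<close>

lemma common_point_limit:
  fixes p :: "'i \<Rightarrow> 'a::heine_borel"
  assumes "I \<noteq> {}" "\<And>s. s > r \<Longrightarrow> \<exists>x. \<forall>i\<in>I. dist (p i) x \<le> s"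
  shows "\<exists>x. \<forall>i\<in>I. dist (p i) x \<le> r"
proof -
  define F where "F n = (\<Inter>i\<in>I. cball (p i) (r + 1 / real (Suc n)))" for n
  obtain i0 where i0: "i0 \<in> I" using assms(1) by auto
  have "\<Inter>(range F) \<noteq> {}"
  proof (rule compact_nest)
    show "compact (F n)" for n
      unfolding compact_eq_bounded_closed F_def
      using i0 by (auto intro: bounded_subset[OF bounded_cball] closed_INT)
    show "F n \<noteq> {}" for n
    proof -
      obtain x where "\<forall>i\<in>I. dist (p i) x \<le> r + 1 / real (Suc n)"
        using assms(2)[of "r + 1 / real (Suc n)"] by auto
      then have "x \<in> F n" by (simp add: F_def)
      then show ?thesis by blast
    qed
    show "F n \<subseteq> F m" if "m \<le> n" for m n
      using that by (fastforce simp: F_def frac_le intro: order_trans)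
  qed
  then obtain x where "x \<in> \<Inter>(range F)" by blast
  then have x: "dist (p i) x \<le> r + 1 / real (Suc n)" if "i \<in> I" for i n
    using that by (auto simp: F_def)
  have "dist (p i) x \<le> r" if "i \<in> I" for i
  proof (rule field_le_epsilon)
    fix e :: real assume "e > 0"
    then obtain n where "1 / real (Suc n) < e"
      by (metis nat_approx_posE)
    with x[OF that, of n] show "dist (p i) x \<le> r + e" by simp
  qed
  then show ?thesis by blast
qed

lemma nerve_mono: "r \<le> s \<Longrightarrow> nerve N p r \<subseteq> nerve N p s"
  unfolding nerve_def by (auto intro: order_trans)

lemma finite_nerve: "finite (nerve N p r)"
  by (rule finite_subset[of _ "Pow {..<N}"]) (auto simp: nerve_def)

text \<open>By compactness each non-face remains a non-face at slightly larger radii, and there are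
  finitely many non-faces. This makes closed balls as tractable as open ones.\<close>

lemma nerve_stable:
  fixes p :: "nat \<Rightarrow> 'a::heine_borel"
  obtains e where "e > 0" "nerve N p (r + e) = nerve N p r"
proof -
  have "\<forall>\<^sub>F e in at_right 0. I \<notin> nerve N p (r + e)" if I: "I \<in> Pow {..<N} - nerve N p r" for I
  proof (cases "I = {}")
    case False
    then have "\<not> (\<exists>x. \<forall>i\<in>I. dist (p i) x \<le> r)"
      using I by (auto simp: nerve_def)
    then obtain s where s: "s > r" "\<not> (\<exists>x. \<forall>i\<in>I. dist (p i) x \<le> s)"
      using common_point_limit[OF False, of r p] by metis
    have "\<forall>\<^sub>F e in at_right 0. e < s - r"
      using s(1) by (intro eventually_at_rightI[of 0 "s - r"]) auto
    then show ?thesis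
    proof (rule eventually_mono)
      fix e assume "e < s - r"
      then have "nerve N p (r + e) \<subseteq> nerve N p s" by (intro nerve_mono) simp
      moreover have "I \<notin> nerve N p s" using s(2) by (simp add: nerve_def)
      ultimately show "I \<notin> nerve N p (r + e)" by blast
    qed
  qed (simp add: nerve_def)
  then have "\<forall>\<^sub>F e in at_right 0. \<forall>I\<in>Pow {..<N} - nerve N p r. I \<notin> nerve N p (r + e)"
    by (intro eventually_ball_finite ballI) simp_all
  moreover have "\<forall>\<^sub>F e in at_right 0. (0::real) < e"
    by (rule eventually_at_right_less)
  ultimately have "\<forall>\<^sub>F e in at_right 0. 0 < e \<and> nerve N p (r + e) = nerve N p r"
  proof eventually_elim
    case (elim e)
    have "nerve N p (r + e) \<subseteq> Pow {..<N}" by (auto simp: nerve_def)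
    moreover have "nerve N p r \<subseteq> nerve N p (r + e)" using elim by (intro nerve_mono) simp
    ultimately show ?case using elim by blast
  qed
  then obtain e where "0 < e" "nerve N p (r + e) = nerve N p r"
    using eventually_happens'[OF trivial_limit_at_right_real] by blast
  then show ?thesis by (rule that)
qed

text \<open>The realization lives in a function space with the product topology, so continuity of
  the straight-line homotopy is checked one coordinate at a time.\<close>

lemma homotopic_linear_fun:
  fixes f g :: "'b::topological_space \<Rightarrow> 'i \<Rightarrow> real"
  assumes f: "continuous_on X f" and g: "continuous_on X g"
    and Y: "\<And>x t. x \<in> X \<Longrightarrow> 0 \<le> t \<Longrightarrow> t \<le> 1 \<Longrightarrow> (\<lambda>i. (1 - t) * f x i + t * g x i) \<in> Y"
  shows "homotopic_with_canon (\<lambda>_. True) X Y f g"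
proof -
  have co: "continuous_on ({0..1} \<times> X) (\<lambda>z. h (snd z) i)" if "continuous_on X h"
    for h :: "'b \<Rightarrow> 'i \<Rightarrow> real" and i
    by (rule continuous_on_compose2[OF continuous_on_product_then_coordinatewise[OF that]
          continuous_on_snd[OF continuous_on_id]]) auto
  show ?thesis
    unfolding homotopic_with_def
  proof (intro exI conjI)
    let ?h = "\<lambda>z :: real \<times> 'b. (\<lambda>i. (1 - fst z) * f (snd z) i + fst z * g (snd z) i)"
    have "continuous_on ({0..1} \<times> X) ?h"
      by (intro continuous_on_coordinatewise_then_product continuous_on_add continuous_on_mult
          continuous_on_diff continuous_on_const continuous_on_fst continuous_on_id co f g)
    then show "continuous_map (prod_topology (top_of_set {0..1}) (top_of_set X)) (top_of_set Y) ?h"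
      using Y by (auto simp: prod_topology_subtopology_eu)
  qed auto
qed

text \<open>\<open>f\<close> records how deep a point lies in each ball, and \<open>g\<close>
  averages the common points \<open>c \<tau>\<close> of the faces. The composite
  \<open>g \<circ> f\<close> moves every point inside a single ball. A straight line from
  \<open>f \<circ> g\<close> to the identity may leave the complex, since \<open>g u\<close> can
  miss the balls of indices with small coordinates. The homotopy therefore passes through
  \<open>h\<close>, whose support is contained both in that of \<open>u\<close> and in that of
  \<open>f (g u)\<close>.\<close>

theorem nerve_theorem:
  fixes p :: "nat \<Rightarrow> 'a::euclidean_space"
  shows "top_of_set (\<Union>i<N. cball (p i) r) homotopy_equivalent_space
    top_of_set (realization N (nerve N p r))"
proof -
  define K where "K = nerve N p r"
  define U where "U = (\<Union>i<N. cball (p i) r)"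
  \<comment> \<open>Bumps of radius \<open>r\<close> would vanish on the boundary spheres. With
    radius \<open>r + e\<close> they are positive on the closed balls, and the indices of positive
    bumps still form a face of \<open>K\<close>.\<close>
  obtain e where e: "e > 0" "nerve N p (r + e) = K"
    using nerve_stable[of N p r] by (metis K_def)
  have finK: "finite K" by (simp add: K_def finite_nerve)
  have KN: "\<tau> \<subseteq> {..<N}" "\<tau> \<noteq> {}" "finite \<tau>" if "\<tau> \<in> K" for \<tau>
    using that finite_subset[of \<tau> "{..<N}"] by (auto simp: K_def nerve_def)
  define c where "c \<tau> = (SOME x. \<forall>i\<in>\<tau>. dist (p i) x \<le> r)" for \<tau>
  have c: "c \<tau> \<in> cball (p i) r" if "\<tau> \<in> K" "i \<in> \<tau>" for \<tau> i
  proof -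
    have "\<exists>x. \<forall>i\<in>\<tau>. dist (p i) x \<le> r" using that(1) by (auto simp: K_def nerve_def)
    then have "\<forall>i\<in>\<tau>. dist (p i) (c \<tau>) \<le> r" unfolding c_def by (rule someI_ex)
    with that(2) show ?thesis by auto
  qed
  define f where "f x = (\<lambda>i. max 0 (r + e - dist (p i) x))" for x
  \<comment> \<open>A positive weight forces \<open>\<tau>\<close> to contain every vertex whose coordinate is at least half the largest
    one; \<open>h u\<close> below is supported on such vertices, so \<open>g u\<close> lies in all the balls that \<open>h u\<close> charges.\<close>
  define wt where "wt \<tau> u = (\<Prod>i\<in>\<tau>. u i * (\<Prod>j\<in>{..<N} - \<tau>. max 0 (u i / 2 - u j)))"
    for \<tau> and u :: "nat \<Rightarrow> real"
  define W where "W u = (\<Sum>\<tau>\<in>K. wt \<tau> u)" for u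
  define g where "g u = (\<Sum>\<tau>\<in>K. (wt \<tau> u / W u) *\<^sub>R c \<tau>)" for u
  define h where "h u = (\<lambda>i. \<Prod>j<N. max 0 (u i - u j / 2))" for u :: "nat \<Rightarrow> real"
  let ?R = "realization N K"
  have RD: "0 \<le> u i" if "u \<in> ?R" "i < N" for u i
    using that by (auto simp: realization_def)
  have supp: "{i. i < N \<and> 0 < u i} \<in> K" if "u \<in> ?R" for u
    using that by (auto simp: realization_def)
  have wt0: "0 \<le> wt \<tau> u" if "u \<in> ?R" "\<tau> \<in> K" for \<tau> u
    using that KN[OF that(2)] unfolding wt_def by (intro prod_nonneg mult_nonneg_nonneg ballI) (auto intro: RD)
  have wt_pos: "0 < u i \<and> (\<forall>j<N. j \<notin> \<tau> \<longrightarrow> u j < u i / 2)"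
    if "0 < wt \<tau> u" "u \<in> ?R" "\<tau> \<in> K" "i \<in> \<tau>" for \<tau> u i
  proof -
    have "\<forall>i\<in>\<tau>. u i * (\<Prod>j\<in>{..<N} - \<tau>. max 0 (u i / 2 - u j)) \<noteq> 0"
      using less_imp_neq[OF that(1), symmetric] KN(3)[OF that(3)] by (simp add: wt_def)
    then have *: "u i \<noteq> 0" "\<forall>j\<in>{..<N} - \<tau>. max 0 (u i / 2 - u j) \<noteq> 0"
      using that(4) by (auto simp only: mult_eq_0_iff prod_zero_iff finite_Diff finite_lessThan)
    have "u j < u i / 2" if "j < N" "j \<notin> \<tau>" for j
    proof (rule ccontr)
      assume "\<not> u j < u i / 2"
      then have "max 0 (u i / 2 - u j) = 0" by simp
      with *(2) that show False by blast
    qed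
    moreover have "0 \<le> u i" using RD[OF that(2)] KN(1)[OF that(3)] that(4) by auto
    ultimately show ?thesis using *(1) by auto
  qed
  have Wpos: "0 < W u" if u: "u \<in> ?R" for u
  proof -
    let ?s = "{i. i < N \<and> 0 < u i}"
    have s: "?s \<in> K" using supp[OF u] .
    \<comment> \<open>The coordinates off the support are 0, so each factor
      \<open>u i / 2 - u j\<close> equals \<open>u i / 2\<close>: the support of \<open>u\<close>
      always has positive weight.\<close>
    have "0 < wt ?s u"
      unfolding wt_def
    proof (intro prod_pos mult_pos_pos ballI)
      fix i j assume "i \<in> ?s" "j \<in> {..<N} - ?s"
      moreover then have "u j = 0" using RD[OF u, of j] by auto
      ultimately show "0 < max 0 (u i / 2 - u j)" by auto
    qed auto
    also have "\<dots> \<le> W u"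
      unfolding W_def using s finK wt0[OF u] by (intro member_le_sum) auto
    finally show ?thesis .
  qed
  have g_in: "g u \<in> cball (p i) r" if u: "u \<in> ?R" and i: "i < N" "\<forall>j<N. u j / 2 \<le> u i" for u i
  proof -
    let ?T = "{\<tau>\<in>K. 0 < wt \<tau> u}"
    \<comment> \<open>If \<open>i\<close> were missing from \<tau>, any vertex \<open>k\<close> of
      \<tau> would give \<open>u i < u k / 2\<close>, against the choice of
      \<open>i\<close>.\<close>
    have iT: "i \<in> \<tau>" if "\<tau> \<in> ?T" for \<tau>
    proof (rule ccontr)
      assume "i \<notin> \<tau>"
      have \<tau>: "\<tau> \<in> K" "0 < wt \<tau> u" using that by auto
      obtain k where "k \<in> \<tau>" "k < N" using KN(1,2)[OF \<tau>(1)] by auto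
      with wt_pos[OF \<tau>(2) u \<tau>(1), of k] i \<open>i \<notin> \<tau>\<close> show False by fastforce
    qed
    have eq: "wt \<tau> u = 0" if "\<tau> \<in> K - ?T" for \<tau> using that wt0[OF u] by force
    have "g u = (\<Sum>\<tau>\<in>?T. (wt \<tau> u / W u) *\<^sub>R c \<tau>)"
      unfolding g_def using finK eq by (intro sum.mono_neutral_right) auto
    also have "\<dots> \<in> cball (p i) r"
    proof (rule convex_sum)
      have "(\<Sum>\<tau>\<in>?T. wt \<tau> u) = W u"
        unfolding W_def using finK eq by (intro sum.mono_neutral_left) auto
      then show "(\<Sum>\<tau>\<in>?T. wt \<tau> u / W u) = 1"
        using Wpos[OF u] by (simp flip: sum_divide_distrib)
    qed (use finK Wpos[OF u] iT c in auto)
    finally show ?thesis .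
  qed
  have maxi: "\<exists>i<N. 0 < u i \<and> (\<forall>j<N. u j \<le> u i)" if u: "u \<in> ?R" for u
  proof -
    have ne: "finite (u ` {..<N})" "u ` {..<N} \<noteq> {}" using KN[OF supp[OF u]] by auto
    obtain i where i: "i < N" "u i = Max (u ` {..<N})" using Max_in[OF ne] by auto
    have le: "\<forall>j<N. u j \<le> u i" using i ne by simp
    obtain k where "k < N" "0 < u k" using KN[OF supp[OF u]] by auto
    with le i show ?thesis by (metis less_le_trans)
  qed
  have f0: "0 \<le> f x i" for x i by (simp add: f_def)
  have f_pos: "0 < f x i \<longleftrightarrow> dist (p i) x < r + e" for x i by (auto simp: f_def)
  have f_nerve: "{i. i < N \<and> 0 < f x i} \<in> K" if "i < N" "dist (p i) x \<le> r" for x i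
    unfolding e(2)[symmetric] nerve_def using that e(1)
    by (auto simp: f_pos intro!: exI[of _ x] exI[of _ i])
  have f_in: "f x \<in> ?R" if "x \<in> U" for x
    using that f_nerve by (auto simp: realization_def U_def f_def)
  have g_U: "g u \<in> U" if "u \<in> ?R" for u
  proof -
    obtain i where i: "i < N" "0 < u i" "\<forall>j<N. u j \<le> u i" using maxi[OF \<open>u \<in> ?R\<close>] by blast
    have "g u \<in> cball (p i) r"
      by (rule g_in[OF that i(1)]) (use i RD[OF that] in fastforce)
    with i(1) show ?thesis by (auto simp: U_def)
  qed
  have coord: "continuous_on S (\<lambda>u. u i)" for S :: "(nat \<Rightarrow> real) set" and i
    by (rule continuous_on_subset[OF continuous_on_product_coordinates]) simp
  have cf: "continuous_on S f" for S
    unfolding f_def by (intro continuous_on_coordinatewise_then_product continuous_intros)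
  have cwt: "continuous_on S (wt \<tau>)" for S \<tau>
    unfolding wt_def by (intro continuous_intros coord) auto
  have cW: "continuous_on S W" for S
    unfolding W_def by (intro continuous_on_sum cwt)
  have "W u \<noteq> 0" if "u \<in> ?R" for u using Wpos[OF that] by simp
  then have cg: "continuous_on ?R g"
    unfolding g_def by (intro continuous_on_sum continuous_on_scaleR continuous_on_divide cwt cW continuous_on_const) blast
  have ch: "continuous_on S h" for S
    unfolding h_def by (intro continuous_on_coordinatewise_then_product continuous_intros coord) simp
  have h0: "0 \<le> h u i" for u i unfolding h_def by (auto intro!: prod_nonneg)
  have h_pos: "0 < u i \<and> (\<forall>j<N. u j / 2 \<le> u i)" if "0 < h u i" "i < N" for u i
  proof -
    have *: "u j / 2 < u i" if "j < N" for j
    proof (rule ccontr)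
      assume "\<not> u j / 2 < u i"
      then have "max 0 (u i - u j / 2) = 0" by simp
      then have "h u i = 0" unfolding h_def using that by (intro prod_zero) auto
      with \<open>0 < h u i\<close> show False by simp
    qed
    from *[OF that(2)] * show ?thesis by (auto intro: less_imp_le)
  qed
  have h_max: "0 < h u i" if "i < N" "0 < u i" "\<forall>j<N. u j \<le> u i" for u i
    unfolding h_def using that by (intro prod_pos) force
  have 1: "homotopic_with_canon (\<lambda>x. True) U U (g \<circ> f) id"
  proof (rule homotopic_with_linear)
    show "continuous_on U (g \<circ> f)"
      by (rule continuous_on_compose[OF cf continuous_on_subset[OF cg]]) (use f_in in auto)
    fix x assume x: "x \<in> U"
    obtain i where i: "i < N" "0 < f x i" "\<forall>j<N. f x j \<le> f x i" using maxi[OF f_in[OF x]] by blast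
    obtain k where k: "k < N" "dist (p k) x \<le> r" using x by (auto simp: U_def)
    \<comment> \<open>The coordinate of a ball of radius \<open>r\<close> containing
      \<open>x\<close> is at least \<open>e\<close>, hence so is the largest one. This puts
      \<open>x\<close> in the ball of index \<open>i\<close> with radius \<open>r\<close> and not
      merely \<open>r + e\<close>.\<close>
    have "f x k \<le> f x i" using i k by blast
    then have "x \<in> cball (p i) r" using k(2) e(1) by (auto simp: f_def max_def split: if_splits)
    moreover have "g (f x) \<in> cball (p i) r"
      by (rule g_in[OF f_in[OF x] i(1)]) (use i RD[OF f_in[OF x]] in fastforce)
    ultimately have "closed_segment (g (f x)) x \<subseteq> cball (p i) r"
      by (simp add: closed_segment_subset)
    then show "closed_segment ((g \<circ> f) x) (id x) \<subseteq> U" using i(1) by (auto simp: U_def)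
  qed (simp add: continuous_on_id)
  have 2: "homotopic_with_canon (\<lambda>x. True) ?R ?R h id"
  proof (rule homotopic_linear_fun)
    fix u :: "nat \<Rightarrow> real" and t :: real
    assume u: "u \<in> ?R" and t: "0 \<le> t" "t \<le> 1"
    obtain i where i: "i < N" "0 < u i" "\<forall>j<N. u j \<le> u i" using maxi[OF u] by blast
    show "(\<lambda>i. (1 - t) * h u i + t * id u i) \<in> ?R"
      unfolding K_def
    proof (rule realizationI[OF _ i(1)])
      show "0 < (1 - t) * h u i + t * id u i"
        using h_max[OF i] i(2) t by (cases "t = 0") (auto intro!: add_nonneg_pos)
      show "{i. i < N \<and> 0 < u i} \<in> nerve N p r" using supp[OF u] by (simp add: K_def)
      show "0 \<le> (1 - t) * h u i + t * id u i" if "i < N" for i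
        using h0 RD[OF u that] t by auto
      show "j \<in> {i. i < N \<and> 0 < u i}" if j: "j < N" and pos: "0 < (1 - t) * h u j + t * id u j" for j
      proof -
        have "0 < h u j \<or> 0 < u j" using pos h0[of u j] RD[OF u j]
          by (cases "h u j = 0"; cases "u j = 0") auto
        with h_pos[of u j] j show ?thesis by auto
      qed
    qed
  qed (use ch in \<open>auto simp: continuous_on_id\<close>)
  have 3: "homotopic_with_canon (\<lambda>x. True) ?R ?R (f \<circ> g) h"
  proof (rule homotopic_linear_fun)
    fix u :: "nat \<Rightarrow> real" and t :: real
    assume u: "u \<in> ?R" and t: "0 \<le> t" "t \<le> 1"
    obtain i where i: "i < N" "0 < u i" "\<forall>j<N. u j \<le> u i" using maxi[OF u] by blast
    have fg: "0 < f (g u) j" if "j < N" "0 < h u j" for j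
      using g_in[OF u that(1)] h_pos[OF that(2,1)] e(1) by (auto simp: f_pos)
    have gi: "dist (p i) (g u) \<le> r"
      using g_in[OF u i(1)] h_pos[OF h_max[OF i] i(1)] by auto
    show "(\<lambda>i. (1 - t) * (f \<circ> g) u i + t * h u i) \<in> ?R"
      unfolding K_def
    proof (rule realizationI[OF _ i(1)])
      show "0 < (1 - t) * (f \<circ> g) u i + t * h u i"
        using h_max[OF i] fg[OF i(1)] t by (cases "t = 0") (auto intro!: add_nonneg_pos)
      show "{j. j < N \<and> 0 < f (g u) j} \<in> nerve N p r"
        using f_nerve[OF i(1) gi] by (simp add: K_def)
      show "0 \<le> (1 - t) * (f \<circ> g) u i + t * h u i" if "i < N" for i
        using h0 t by (auto simp: f_def)
      show "j \<in> {j. j < N \<and> 0 < f (g u) j}"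
        if j: "j < N" and pos: "0 < (1 - t) * (f \<circ> g) u j + t * h u j" for j
      proof -
        have "0 < h u j \<or> 0 < f (g u) j" using pos h0[of u j] f0[of "g u" j]
          by (cases "h u j = 0"; cases "f (g u) j = 0") auto
        with fg[OF j] j show ?thesis by auto
      qed
    qed
  qed (use ch in \<open>auto intro!: continuous_on_compose2[OF cf cg] simp: o_def\<close>)
  show ?thesis
    unfolding homotopy_equivalent_space_def K_def[symmetric] U_def[symmetric]
  proof (intro exI conjI)
    show "continuous_map (top_of_set U) (top_of_set ?R) f" using cf f_in by auto
    show "continuous_map (top_of_set ?R) (top_of_set U) g" using cg g_U by auto
    show "homotopic_with_canon (\<lambda>x. True) ?R ?R (f \<circ> g) id"
      using 3 2 by (rule homotopic_with_trans)
  qed (rule 1)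
qed

corollary nerve_eq_imp_homotopy_equivalent:
  fixes p q :: "nat \<Rightarrow> 'a::euclidean_space"
  assumes "nerve N p r = nerve N q r"
  shows "top_of_set (\<Union>i<N. cball (p i) r) homotopy_equivalent_space
    top_of_set (\<Union>i<N. cball (q i) r)"
proof (rule homotopy_eqv_trans)
  show "top_of_set (\<Union>i<N. cball (p i) r) homotopy_equivalent_space
      top_of_set (realization N (nerve N q r))"
    using nerve_theorem[of p r N] unfolding assms .
  show "top_of_set (realization N (nerve N q r)) homotopy_equivalent_space
      top_of_set (\<Union>i<N. cball (q i) r)"
    by (subst homotopy_equivalent_space_sym) (rule nerve_theorem)
qed

subsection \<open>Measurability of homotopy invariants of the union of balls\<close>

text \<open>For positive \<open>e\<close> this rounds each coordinate down to a multiple of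
  \<open>e\<close>. A countable range with a controlled displacement is what the discretization of
  configurations requires.\<close>

definition grid_round :: "real \<Rightarrow> 'a::euclidean_space \<Rightarrow> 'a" where
  "grid_round e x = (\<Sum>b\<in>Basis. (e * of_int \<lfloor>(x \<bullet> b) / e\<rfloor>) *\<^sub>R b)"

lemma dist_grid_round:
  fixes x :: "'a::euclidean_space" and e :: real
  assumes "e > 0"
  shows "dist x (grid_round e x) \<le> real DIM('a) * e"
proof -
  have "x - grid_round e x = (\<Sum>b\<in>Basis. (x \<bullet> b - e * of_int \<lfloor>(x \<bullet> b) / e\<rfloor>) *\<^sub>R b)"
    by (subst euclidean_representation[of x, symmetric])
      (simp add: grid_round_def scaleR_diff_left sum_subtractf del: euclidean_representation)
  also have "norm \<dots> \<le> (\<Sum>b\<in>(Basis :: 'a set). e)"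
  proof (rule sum_norm_le)
    fix b :: 'a assume b: "b \<in> Basis"
    let ?f = "of_int \<lfloor>(x \<bullet> b) / e\<rfloor> :: real"
    have "e * ?f \<le> e * ((x \<bullet> b) / e)" "e * ((x \<bullet> b) / e) \<le> e * (?f + 1)"
      using assms by (intro mult_left_mono; linarith)+
    then have "\<bar>x \<bullet> b - e * ?f\<bar> \<le> e" using assms by (simp add: abs_le_iff algebra_simps)
    with b show "norm ((x \<bullet> b - e * ?f) *\<^sub>R b) \<le> e" by simp
  qed
  finally show ?thesis by (simp add: dist_norm)
qed

lemma measurable_grid_round: "grid_round e \<in> measurable borel borel"
  unfolding grid_round_def by measurable

lemma countable_range_grid_round: "countable (range (grid_round e :: 'a::euclidean_space \<Rightarrow> 'a))"
proof -
  let ?F = "Pi\<^sub>E (Basis :: 'a set) (\<lambda>_. UNIV :: int set)"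
  have "grid_round e x \<in> (\<lambda>g. \<Sum>b\<in>Basis. (e * of_int (g b)) *\<^sub>R b) ` ?F" for x :: 'a
    by (rule image_eqI[of _ _ "\<lambda>b\<in>Basis. \<lfloor>(x \<bullet> b) / e\<rfloor>"]) (simp_all add: grid_round_def)
  then have "range (grid_round e :: 'a \<Rightarrow> 'a) \<subseteq> (\<lambda>g. \<Sum>b\<in>Basis. (e * of_int (g b)) *\<^sub>R b) ` ?F"
    by blast
  moreover have "countable ?F" by (intro countable_PiE) auto
  ultimately show ?thesis by (meson countable_image countable_subset)
qed

lemma count_image_mset_points_in: "count (image_mset \<rho> X) y = points_in (\<rho> -` {y}) X"
  by (induction X) (auto simp: points_in_def)

text \<open>A countable set carries only countably many finite multisets, and each of them is
  determined by its multiplicities, which are the counts of points in the fibres of \<rho>. So every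
  predicate \<Phi> of the image yields a measurable event.\<close>

lemma sets_image_mset_countable:
  fixes \<rho> :: "'a::topological_space \<Rightarrow> 'b::t1_space"
  assumes X: "\<And>A. A \<in> sets borel \<Longrightarrow> (\<lambda>w. points_in A (X w)) \<in> measurable \<Omega> (count_space UNIV)"
    and \<rho>: "\<rho> \<in> measurable borel borel" "countable (range \<rho>)"
  shows "{w \<in> space \<Omega>. \<Phi> (image_mset \<rho> (X w))} \<in> sets \<Omega>"
proof -
  let ?D = "range \<rho>"
  let ?Y = "{Y. set_mset Y \<subseteq> ?D \<and> \<Phi> Y}"
  have "{Y. set_mset Y \<subseteq> ?D} \<subseteq> mset ` lists ?D"
  proof
    fix Y assume Y: "Y \<in> {Y. set_mset Y \<subseteq> ?D}"
    obtain ys where "mset ys = Y" using ex_mset by blast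
    with Y show "Y \<in> mset ` lists ?D" by (intro image_eqI[of _ _ ys]) auto
  qed
  then have "countable {Y. set_mset Y \<subseteq> ?D}"
    using \<rho>(2) by (meson countable_image countable_lists countable_subset)
  then have cY: "countable ?Y" by (rule countable_subset[rotated]) auto
  have eq: "image_mset \<rho> Z = Y \<longleftrightarrow> (\<forall>y\<in>?D. points_in (\<rho> -` {y}) Z = count Y y)"
    if "set_mset Y \<subseteq> ?D" for Y Z
  proof
    assume R: "\<forall>y\<in>?D. points_in (\<rho> -` {y}) Z = count Y y"
    show "image_mset \<rho> Z = Y"
    proof (rule multiset_eqI)
      fix y
      show "count (image_mset \<rho> Z) y = count Y y"
      proof (cases "y \<in> ?D")
        case False
        then have "y \<notin># image_mset \<rho> Z" "y \<notin># Y" using that by auto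
        then show ?thesis by (simp only: not_in_iff)
      qed (use R in \<open>simp only: count_image_mset_points_in\<close>)
    qed
  qed (auto simp flip: count_image_mset_points_in)
  have "\<Phi> (image_mset \<rho> Z) \<longleftrightarrow> (\<exists>Y\<in>?Y. \<forall>y\<in>?D. points_in (\<rho> -` {y}) Z = count Y y)" for Z
  proof -
    have "set_mset (image_mset \<rho> Z) \<subseteq> ?D" by auto
    then have "\<Phi> (image_mset \<rho> Z) \<longleftrightarrow> (\<exists>Y\<in>?Y. image_mset \<rho> Z = Y)" by blast
    then show ?thesis using eq by blast
  qed
  then have "{w \<in> space \<Omega>. \<Phi> (image_mset \<rho> (X w))} =
      {w \<in> space \<Omega>. \<exists>Y\<in>?Y. \<forall>y\<in>?D. points_in (\<rho> -` {y}) (X w) = count Y y}"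
    by (simp only:)
  also have "\<dots> \<in> sets \<Omega>"
  proof (intro sets.sets_Collect_countable_Ex'[OF _ cY] sets.sets_Collect_countable_All'[OF _ \<rho>(2)])
    fix Y y
    have "\<rho> -` {y} \<in> sets borel" using measurable_sets[OF \<rho>(1), of "{y}"] by simp
    then have "(\<lambda>w. points_in (\<rho> -` {y}) (X w)) \<in> measurable \<Omega> (count_space UNIV)" by (rule X)
    from measurable_sets[OF this, of "{count Y y}"]
    show "{w \<in> space \<Omega>. points_in (\<rho> -` {y}) (X w) = count Y y} \<in> sets \<Omega>"
      by (simp add: vimage_def Int_def conj_commute)
  qed
  finally show ?thesis .
qed

text \<open>Allows a listing of the rounded points to be read as the rounding of a listing of the
  original ones, so that an index denotes the same point before and after rounding.\<close>

lemma mset_eq_image_mset_lift: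
  assumes "mset ys = image_mset f X"
  shows "\<exists>xs. mset xs = X \<and> map f xs = ys"
  using assms
proof (induction ys arbitrary: X)
  case Nil
  then show ?case by simp
next
  case (Cons y ys)
  then have "image_mset f X = add_mset y (mset ys)" by simp
  from msed_map_invR[OF this] obtain X' x where X: "X = add_mset x X'" "f x = y" "image_mset f X' = mset ys"
    by blast
  then obtain xs where "mset xs = X'" "map f xs = ys" using Cons.IH[of X'] by auto
  with X show ?case by (intro exI[of _ "x # xs"]) simp
qed

lemma finite_lists_mset: "finite {xs. mset xs = X}"
proof -
  have "{xs. mset xs = X} \<subseteq> {xs. set xs \<subseteq> set_mset X \<and> length xs = size X}" by auto
  then show ?thesis using finite_lists_length_eq[of "set_mset X" "size X"] finite_subset by auto
qed

lemma nerve_translate: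
  assumes "I \<in> nerve N p r" "\<And>i. i < N \<Longrightarrow> dist (q i) (p i) \<le> e"
  shows "I \<in> nerve N q (r + e)"
proof -
  obtain x where I: "I \<subseteq> {..<N}" "I \<noteq> {}" and x: "\<forall>i\<in>I. dist (p i) x \<le> r"
    using assms(1) by (auto simp: nerve_def)
  have "dist (q i) x \<le> r + e" if "i \<in> I" for i
    using dist_triangle[of "q i" x "p i"] assms(2)[of i] x that I by fastforce
  with I show ?thesis unfolding nerve_def by blast
qed

text \<open>The nerve of the rounded points at scale \<open>r\<close> plus an error term recovers the nerve of the
  points: its faces are closed conditions on the configuration, its non-faces are open ones.\<close>

lemma sets_nerve_eq:
  fixes X :: "'w \<Rightarrow> 'a::euclidean_space multiset"
  assumes X: "\<And>A. A \<in> sets borel \<Longrightarrow> (\<lambda>w. points_in A (X w)) \<in> measurable \<Omega> (count_space UNIV)"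
    and K: "K \<subseteq> Pow {..<N} - {{}}"
  shows "{w \<in> space \<Omega>. \<exists>ps. mset ps = X w \<and> length ps = N \<and> nerve N ((!) ps) r = K} \<in> sets \<Omega>"
proof -
  define e where "e l = 1 / real (Suc l)" for l
  have e0: "0 < e l" for l by (simp add: e_def)
  have e_mono: "e l \<le> e j" if "j \<le> l" for j l using that by (simp add: e_def frac_le)
  have e_small: "\<exists>j. e j < s" if "0 < s" for s
    unfolding e_def using that by (rule nat_approx_posE) auto
  define \<rho> where "\<rho> l = (grid_round (e l / real DIM('a)) :: 'a \<Rightarrow> 'a)" for l
  have \<rho>: "dist x (\<rho> l x) \<le> e l" for x l
    using dist_grid_round[of "e l / real DIM('a)" x] e0[of l] by (simp add: \<rho>_def)
  \<comment> \<open>The two margins have different roles: \<open>e l\<close> shrinks with the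
    rounding error and tests the faces, while the fixed gap \<open>e j\<close> certifies that no
    non-face appears as a face at a slightly larger radius.\<close>
  define G where "G j l Y \<longleftrightarrow> (\<exists>ys. mset ys = Y \<and> length ys = N \<and>
      K \<subseteq> nerve N ((!) ys) (r + e l) \<and> nerve N ((!) ys) (r + e j) \<subseteq> K)" for j l and Y :: "'a multiset"
  have down: "I \<in> nerve N ((!) (map (\<rho> l) ps)) (s + e l)" if "I \<in> nerve N ((!) ps) s" "length ps = N" for I l ps s
    using that(1) by (rule nerve_translate) (use \<rho> that in \<open>simp add: dist_commute\<close>)
  have up: "I \<in> nerve N ((!) ps) (s + e l)" if "I \<in> nerve N ((!) (map (\<rho> l) ps)) s" "length ps = N" for I l ps s
    using that(1) by (rule nerve_translate) (use \<rho> that in simp)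
  have iff: "(\<exists>ps. mset ps = Z \<and> length ps = N \<and> nerve N ((!) ps) r = K) \<longleftrightarrow>
      (\<exists>j. \<forall>l\<in>{j..}. G j l (image_mset (\<rho> l) Z))" for Z
  proof
    assume "\<exists>ps. mset ps = Z \<and> length ps = N \<and> nerve N ((!) ps) r = K"
    then obtain ps where ps: "mset ps = Z" "length ps = N" "nerve N ((!) ps) r = K" by blast
    obtain d where d: "d > 0" "nerve N ((!) ps) (r + d) = K"
      using nerve_stable[of N "(!) ps" r] ps(3) by metis
    obtain j where j: "e j < d / 2" using e_small[of "d / 2"] d(1) by auto
    have "G j l (image_mset (\<rho> l) Z)" if l: "l \<in> {j..}" for l
      unfolding G_def
    proof (intro exI[of _ "map (\<rho> l) ps"] conjI)
      show "K \<subseteq> nerve N ((!) (map (\<rho> l) ps)) (r + e l)" using down ps(2,3) by blast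
      have "r + e j + e l \<le> r + d" using e_mono[of j l] l j by simp
      then have "nerve N ((!) ps) (r + e j + e l) \<subseteq> K" using nerve_mono d(2) by metis
      then show "nerve N ((!) (map (\<rho> l) ps)) (r + e j) \<subseteq> K" using up[OF _ ps(2)] by blast
    qed (use ps in auto)
    then show "\<exists>j. \<forall>l\<in>{j..}. G j l (image_mset (\<rho> l) Z)" by blast
  next
    assume "\<exists>j. \<forall>l\<in>{j..}. G j l (image_mset (\<rho> l) Z)"
    then obtain j where j: "\<And>l. l \<in> {j..} \<Longrightarrow> G j l (image_mset (\<rho> l) Z)" by blast
    have "\<exists>ps. mset ps = Z \<and> length ps = N \<and> K \<subseteq> nerve N ((!) (map (\<rho> l) ps)) (r + e l) \<and>
        nerve N ((!) (map (\<rho> l) ps)) (r + e j) \<subseteq> K" if l: "l \<in> {j..}" for l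
    proof -
      obtain ys where ys: "mset ys = image_mset (\<rho> l) Z" "length ys = N"
        "K \<subseteq> nerve N ((!) ys) (r + e l)" "nerve N ((!) ys) (r + e j) \<subseteq> K"
        using j[OF l] unfolding G_def by blast
      obtain ps where ps: "mset ps = Z" "map (\<rho> l) ps = ys"
        using mset_eq_image_mset_lift[OF ys(1)] by blast
      then have "length ps = N" using ys(2) by auto
      with ps ys show ?thesis by (intro exI[of _ ps]) simp
    qed
    then obtain p where p: "\<And>l. l \<in> {j..} \<Longrightarrow> mset (p l) = Z \<and> length (p l) = N \<and>
        K \<subseteq> nerve N ((!) (map (\<rho> l) (p l))) (r + e l) \<and> nerve N ((!) (map (\<rho> l) (p l))) (r + e j) \<subseteq> K"
      by metis
    \<comment> \<open>The listing may vary with \<open>l\<close>, but a multiset has finitely many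
      listings, so one of them serves infinitely many \<open>l\<close>.\<close>
    have "finite (p ` {j..})" by (rule finite_subset[OF _ finite_lists_mset[of Z]]) (use p in auto)
    then obtain l0 where l0: "l0 \<in> {j..}" "infinite {l \<in> {j..}. p l = p l0}"
      using pigeonhole_infinite[OF infinite_Ici[of j]] by blast
    define ps where "ps = p l0"
    have ps: "mset ps = Z" "length ps = N" using p[OF l0(1)] by (auto simp: ps_def)
    have large: "\<exists>l\<ge>i. l \<in> {j..} \<and> p l = ps" for i
      using l0(2) unfolding infinite_nat_iff_unbounded_le ps_def by auto
    have "I \<in> nerve N ((!) ps) r" if I: "I \<in> K" for I
    proof -
      have I': "I \<subseteq> {..<N}" "I \<noteq> {}" using I K by auto
      have "\<exists>x. \<forall>i\<in>I. dist (ps ! i) x \<le> r"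
      proof (rule common_point_limit[OF I'(2)])
        fix s assume s: "r < s"
        obtain i where i: "e i < (s - r) / 2" using e_small[of "(s - r) / 2"] s by auto
        obtain l where l: "l \<ge> i" "l \<in> {j..}" "p l = ps" using large by blast
        have "I \<in> nerve N ((!) (map (\<rho> l) ps)) (r + e l)" using p[OF l(2)] I l(3) by blast
        then have "I \<in> nerve N ((!) ps) (r + e l + e l)" using ps(2) by (rule up)
        moreover have "r + e l + e l \<le> s" using e_mono[OF l(1)] i by (simp add: field_simps)
        ultimately have "I \<in> nerve N ((!) ps) s" using nerve_mono by blast
        then show "\<exists>x. \<forall>i\<in>I. dist (ps ! i) x \<le> s" by (simp add: nerve_def)
      qed
      with I' show ?thesis by (simp add: nerve_def)
    qed
    moreover have "I \<in> K" if I: "I \<in> nerve N ((!) ps) r" for I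
    proof -
      have "I \<in> nerve N ((!) (map (\<rho> l0) ps)) (r + e l0)" using I ps(2) by (rule down)
      moreover have "e l0 \<le> e j" using e_mono l0(1) by simp
      ultimately have "I \<in> nerve N ((!) (map (\<rho> l0) ps)) (r + e j)"
        using nerve_mono[of "r + e l0" "r + e j" N "(!) (map (\<rho> l0) ps)"] by auto
      then show ?thesis using p[OF l0(1)] by (auto simp: ps_def)
    qed
    ultimately have "nerve N ((!) ps) r = K" by blast
    with ps show "\<exists>ps. mset ps = Z \<and> length ps = N \<and> nerve N ((!) ps) r = K" by blast
  qed
  have "{w \<in> space \<Omega>. \<exists>ps. mset ps = X w \<and> length ps = N \<and> nerve N ((!) ps) r = K} =
      {w \<in> space \<Omega>. \<exists>j. \<forall>l\<in>{j..}. G j l (image_mset (\<rho> l) (X w))}"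
    by (simp only: iff)
  also have "\<dots> \<in> sets \<Omega>"
  proof (intro sets.sets_Collect_countable_Ex sets.sets_Collect_countable_All')
    show "{w \<in> space \<Omega>. G j l (image_mset (\<rho> l) (X w))} \<in> sets \<Omega>" for j l
      unfolding \<rho>_def
      by (rule sets_image_mset_countable[OF X measurable_grid_round countable_range_grid_round])
  qed simp
  finally show ?thesis .
qed

text \<open>Configurations with equal nerves have homotopy equivalent unions, so \<open>Q\<close> is
  decided by whether the nerve of some listing belongs to the finite collection
  \<open>\<K> N\<close>. The event becomes a countable union of events of
  \<open>sets_nerve_eq\<close>, however complicated \<open>Q\<close> is.\<close>

lemma sets_ball_union_homotopy_invariant:
  fixes X :: "'w \<Rightarrow> 'a::euclidean_space multiset"
  assumes X: "\<And>A. A \<in> sets borel \<Longrightarrow> (\<lambda>w. points_in A (X w)) \<in> measurable \<Omega> (count_space UNIV)"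
    and inv: "\<And>U V. top_of_set U homotopy_equivalent_space top_of_set V \<Longrightarrow> Q U \<Longrightarrow> Q V"
  shows "{w \<in> space \<Omega>. Q (ball_union (set_mset (X w)) r)} \<in> sets \<Omega>"
proof -
  define \<K> where "\<K> N = {K. \<exists>qs :: 'a list. length qs = N \<and> nerve N ((!) qs) r = K \<and> Q (ball_union (set qs) r)}" for N
  have union: "ball_union (set ps) r = (\<Union>i<length ps. cball (ps ! i) r)" for ps :: "'a list"
    by (auto simp: ball_union_def set_conv_nth)
  have KP: "\<K> N \<subseteq> Pow (Pow {..<N} - {{}})" for N by (auto simp: \<K>_def nerve_def)
  have cK: "countable (\<K> N)" for N
    by (rule countable_finite, rule finite_subset[OF KP]) simp
  have iff: "Q (ball_union (set_mset (X w)) r) \<longleftrightarrow>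
      (\<exists>N. \<exists>K\<in>\<K> N. \<exists>ps. mset ps = X w \<and> length ps = N \<and> nerve N ((!) ps) r = K)" for w
  proof
    assume Q: "Q (ball_union (set_mset (X w)) r)"
    obtain ps where ps: "mset ps = X w" using ex_mset by blast
    then have "nerve (length ps) ((!) ps) r \<in> \<K> (length ps)" using Q by (auto simp: \<K>_def simp flip: ps)
    with ps show "\<exists>N. \<exists>K\<in>\<K> N. \<exists>ps. mset ps = X w \<and> length ps = N \<and> nerve N ((!) ps) r = K" by blast
  next
    assume "\<exists>N. \<exists>K\<in>\<K> N. \<exists>ps. mset ps = X w \<and> length ps = N \<and> nerve N ((!) ps) r = K"
    then obtain ps qs where *: "mset ps = X w" "length qs = length ps"
      "nerve (length ps) ((!) qs) r = nerve (length ps) ((!) ps) r" "Q (ball_union (set qs) r)"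
      by (auto simp: \<K>_def)
    have "top_of_set (ball_union (set qs) r) homotopy_equivalent_space top_of_set (ball_union (set ps) r)"
      unfolding union *(2) by (rule nerve_eq_imp_homotopy_equivalent[OF *(3)])
    with *(4) have "Q (ball_union (set ps) r)" by (rule inv[rotated])
    then show "Q (ball_union (set_mset (X w)) r)" by (simp flip: *(1))
  qed
  have K_sets: "{w \<in> space \<Omega>. \<exists>ps. mset ps = X w \<and> length ps = N \<and> nerve N ((!) ps) r = K} \<in> sets \<Omega>"
    if "K \<in> \<K> N" for N K
    using KP that by (intro sets_nerve_eq X) auto
  have "{w \<in> space \<Omega>. \<exists>N. \<exists>K\<in>\<K> N. \<exists>ps. mset ps = X w \<and> length ps = N \<and> nerve N ((!) ps) r = K} \<in> sets \<Omega>"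
    by (intro sets.sets_Collect_countable_Ex sets.sets_Collect_countable_Ex' cK K_sets)
  then show ?thesis by (simp only: iff)
qed

subsection \<open>Smooth charts\<close>

text \<open>\<open>C_on\<close> is phrased with \<open>frechet_derivative\<close>; on an open set
  this lemma allows the derivative to be replaced by an explicit formula at every order.\<close>

lemma C_on_cong:
  assumes "open U" "\<And>x. x \<in> U \<Longrightarrow> f x = g x" "C_on n U f"
  shows "C_on n U g"
  using assms(2,3)
proof (induction n arbitrary: f g)
  case 0
  then show ?case by (simp cong: continuous_on_cong)
next
  case (Suc n)
  have d: "f differentiable at x" if "x \<in> U" for x
    using Suc.prems(2) that by simp
  have "g differentiable at x" if x: "x \<in> U" for x
  proof -
    obtain D where "(f has_derivative D) (at x)"
      using d[OF x] unfolding differentiable_def by blast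
    then have "(g has_derivative D) (at x)"
      using assms(1) x Suc.prems(1) by (rule has_derivative_transform_within_open)
    then show ?thesis unfolding differentiable_def by blast
  qed
  moreover have eq: "frechet_derivative f (at x) = frechet_derivative g (at x)" if "x \<in> U" for x
    using d[OF that] assms(1) that Suc.prems(1) by (rule frechet_derivative_transform_within_open)
  moreover have "C_on n U (\<lambda>x. frechet_derivative g (at x) v)" for v
    by (rule Suc.IH[of "\<lambda>x. frechet_derivative f (at x) v"]) (use eq Suc.prems(2) in simp_all)
  ultimately show ?case by simp
qed

lemma C_on_postcompose_affine:
  assumes T: "bounded_linear T" and U: "open U" and f: "C_on n U f"
  shows "C_on n U (\<lambda>x. T (f x) + c)"
  using f
proof (induction n arbitrary: f c)
  case 0
  then show ?case
    by (auto intro!: continuous_intros bounded_linear.continuous_on[OF T])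
next
  case (Suc n)
  have d: "((\<lambda>x. T (f x) + c) has_derivative (\<lambda>v. T (frechet_derivative f (at x) v))) (at x)"
    if "x \<in> U" for x
  proof -
    have "(f has_derivative frechet_derivative f (at x)) (at x)"
      using Suc.prems that frechet_derivative_works by auto
    from has_derivative_add_const[OF bounded_linear.has_derivative[OF T this]]
    show ?thesis .
  qed
  \<comment> \<open>Differentiation removes the constant, so the induction hypothesis is applied
    with constant 0; hence the induction is over arbitrary \<open>c\<close>.\<close>
  have "C_on n U (\<lambda>x. T (frechet_derivative f (at x) v) + 0)" for v
    using Suc.prems by (intro Suc.IH) auto
  then have "C_on n U (\<lambda>x. frechet_derivative (\<lambda>x. T (f x) + c) (at x) v)" for v
    by (rule C_on_cong[OF U, rotated]) (simp flip: frechet_derivative_at[OF d])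
  moreover have "(\<lambda>x. T (f x) + c) differentiable at x" if "x \<in> U" for x
    using d[OF that] unfolding differentiable_def by blast
  ultimately show ?case by simp
qed

lemma C_on_precompose_affine:
  assumes S: "linear (S :: 'a \<Rightarrow> 'a::euclidean_space)" and U: "open U" and f: "C_on n U f"
  shows "C_on n ((\<lambda>y. S y + a) -` U) (\<lambda>y. f (S y + a))"
  using f
proof (induction n arbitrary: f)
  have cS: "continuous_on X (\<lambda>y. S y + a)" for X
    using S by (intro continuous_intros linear_continuous_on) (simp add: linear_conv_bounded_linear)
  case 0
  then show ?case
    by (auto intro!: continuous_on_compose2[where g=f and t=U] cS)
next
  case (Suc n)
  let ?V = "(\<lambda>y. S y + a) -` U"
  have cS: "continuous_on X (\<lambda>y. S y + a)" for X
    using S by (intro continuous_intros linear_continuous_on) (simp add: linear_conv_bounded_linear)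
  have V: "open ?V" using U cS[of UNIV] by (simp add: open_vimage)
  have d: "((\<lambda>y. f (S y + a)) has_derivative (\<lambda>v. frechet_derivative f (at (S y + a)) (S v))) (at y)"
    if "y \<in> ?V" for y
  proof -
    have "(f has_derivative frechet_derivative f (at (S y + a))) (at (S y + a))"
      using Suc.prems that frechet_derivative_works by auto
    moreover have "((\<lambda>y. S y + a) has_derivative S) (at y)"
      using S by (intro has_derivative_add_const bounded_linear_imp_has_derivative)
        (simp add: linear_conv_bounded_linear)
    ultimately show ?thesis
      by (rule has_derivative_compose[rotated])
  qed
  have "C_on n ?V (\<lambda>y. frechet_derivative f (at (S y + a)) (S v))" for v
    using Suc.prems by (intro Suc.IH[of "\<lambda>x. frechet_derivative f (at x) (S v)"]) auto
  then have "C_on n ?V (\<lambda>y. frechet_derivative (\<lambda>y. f (S y + a)) (at y) v)" for v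
    by (rule C_on_cong[OF V, rotated]) (simp flip: frechet_derivative_at[OF d])
  moreover have "(\<lambda>y. f (S y + a)) differentiable at y" if "y \<in> ?V" for y
    using d[OF that] unfolding differentiable_def by blast
  ultimately show ?case by simp
qed

text \<open>The volume formula is asserted for every slice chart. Closure of charts under affine
  changes preserving \<open>span B\<close> therefore allows volumes to be computed in a chart that
  is centered at a given point, or whose inverse has an isometric derivative there.\<close>

lemma slice_chart_affine:
  fixes S T :: "'a::euclidean_space \<Rightarrow> 'a"
  assumes ch: "slice_chart m M U V \<phi> \<psi> B" and S: "linear S" and T: "linear T"
    and TS: "\<And>y. T (S y) = y" and ST: "\<And>y. S (T y) = y"
    and SB: "S ` span B \<subseteq> span B" and TB: "T ` span B \<subseteq> span B" and a: "a \<in> span B"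
  shows "slice_chart m M U ((\<lambda>y. S y + a) -` V) (\<lambda>x. T (\<phi> x - a)) (\<lambda>y. \<psi> (S y + a)) B"
proof -
  have U: "open U" and V: "open V" and hom: "homeomorphism U V \<phi> \<psi>" and s\<phi>: "smooth_on U \<phi>"
    and s\<psi>: "smooth_on V \<psi>" and B: "B \<subseteq> Basis" "card B = m" and im: "\<phi> ` (M \<inter> U) = V \<inter> span B"
    using ch by (auto simp: slice_chart_def)
  have cont: "continuous_on X S" "continuous_on X T" for X
    by (rule linear_continuous_on, use S T in \<open>simp add: linear_conv_bounded_linear\<close>)+
  let ?V = "(\<lambda>y. S y + a) -` V"
  have V': "open ?V"
    by (rule open_vimage[OF V], rule continuous_on_add[OF cont(1) continuous_on_const])
  have "homeomorphism U ?V (\<lambda>x. T (\<phi> x - a)) (\<lambda>y. \<psi> (S y + a))"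
  proof (rule homeomorphismI)
    show "continuous_on U (\<lambda>x. T (\<phi> x - a))"
      by (rule continuous_on_compose2[OF cont(2)[of UNIV]])
        (use hom in \<open>auto simp: homeomorphism_def intro!: continuous_on_diff continuous_on_const\<close>)
    show "continuous_on ?V (\<lambda>y. \<psi> (S y + a))"
      by (rule continuous_on_compose2[where g=\<psi> and t=V, OF _ continuous_on_add[OF cont(1) continuous_on_const]])
        (use hom in \<open>auto simp: homeomorphism_def\<close>)
  qed (use hom in \<open>auto simp: homeomorphism_def TS ST\<close>)
  moreover have "smooth_on U (\<lambda>x. T (\<phi> x - a))"
    unfolding smooth_on_def
  proof
    fix n
    have "C_on n U (\<lambda>x. T (\<phi> x) + T (- a))"
      using s\<phi> T U
      by (intro C_on_postcompose_affine) (auto simp: smooth_on_def linear_conv_bounded_linear)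
    then show "C_on n U (\<lambda>x. T (\<phi> x - a))"
      using linear_add[OF T, of "\<phi> x" "- a" for x] by simp
  qed
  moreover have "smooth_on ?V (\<lambda>y. \<psi> (S y + a))"
    using s\<psi> C_on_precompose_affine[OF S V] by (auto simp: smooth_on_def)
  moreover have "(\<lambda>x. T (\<phi> x - a)) ` (M \<inter> U) = ?V \<inter> span B"
  proof -
    have "(\<lambda>x. T (\<phi> x - a)) ` (M \<inter> U) = (\<lambda>y. T (y - a)) ` (V \<inter> span B)"
      by (simp flip: im add: image_image)
    also have "\<dots> = ?V \<inter> span B"
    proof (intro equalityI subsetI)
      fix z assume "z \<in> (\<lambda>y. T (y - a)) ` (V \<inter> span B)"
      then show "z \<in> ?V \<inter> span B"
        using TB a span_diff[of _ B a] by (auto simp: ST)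
    next
      fix z assume "z \<in> ?V \<inter> span B"
      then show "z \<in> (\<lambda>y. T (y - a)) ` (V \<inter> span B)"
        using SB a by (intro image_eqI[of _ _ "S z + a"]) (auto simp: TS intro: span_add)
    qed
    finally show ?thesis .
  qed
  ultimately show ?thesis
    using U V' B by (simp add: slice_chart_def)
qed

section \<open>Mean value and Taylor estimates on balls, and uniform scales on compact sets\<close>

lemma C_on_1_Lipschitz:
  assumes V: "C_on (Suc 0) V g" and sub: "cball a \<rho> \<subseteq> V"
  obtains K where "K \<ge> 0" "\<And>x y. x \<in> cball a \<rho> \<Longrightarrow> y \<in> cball a \<rho> \<Longrightarrow> norm (g x - g y) \<le> K * norm (x - y)"
proof -
  let ?D = "\<lambda>x. frechet_derivative g (at x)"
  have d: "(g has_derivative ?D x) (at x)" if "x \<in> cball a \<rho>" for x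
    using V that sub frechet_derivative_works by fastforce
  have "\<exists>b\<ge>0. \<forall>x\<in>cball a \<rho>. norm (?D x w) \<le> b" for w
  proof -
    have "continuous_on (cball a \<rho>) (\<lambda>x. ?D x w)"
      using V sub by (auto intro: continuous_on_subset)
    then have "bounded ((\<lambda>x. ?D x w) ` cball a \<rho>)"
      by (intro compact_imp_bounded compact_continuous_image) auto
    then obtain b where "\<forall>x\<in>cball a \<rho>. norm (?D x w) \<le> b"
      by (auto simp: bounded_iff)
    then show ?thesis by (intro exI[of _ "max 0 b"]) auto
  qed
  then obtain b where b: "\<And>w. b w \<ge> 0" "\<And>w x. x \<in> cball a \<rho> \<Longrightarrow> norm (?D x w) \<le> b w"
    by metis
  show ?thesis
  proof (rule that)
    show "(\<Sum>w\<in>Basis. b w) \<ge> 0" using b by (intro sum_nonneg) auto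
    fix x y assume xy: "x \<in> cball a \<rho>" "y \<in> cball a \<rho>"
    show "norm (g x - g y) \<le> (\<Sum>w\<in>Basis. b w) * norm (x - y)"
    proof (rule differentiable_bound[OF convex_cball _ _ xy])
      fix z assume z: "z \<in> cball a \<rho>"
      show "(g has_derivative ?D z) (at z within cball a \<rho>)"
        using d[OF z] by (rule has_derivative_at_withinI)
      have lin: "linear (?D z)" using d[OF z] has_derivative_linear by blast
      show "onorm (?D z) \<le> (\<Sum>w\<in>Basis. b w)"
      proof (rule onorm_le)
        fix v
        have "norm (?D z v) = norm (?D z (\<Sum>w\<in>Basis. (v \<bullet> w) *\<^sub>R w))"
          by (simp add: euclidean_representation)
        also have "\<dots> = norm (\<Sum>w\<in>Basis. (v \<bullet> w) *\<^sub>R ?D z w)"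
          by (simp add: linear_sum[OF lin] linear_scale[OF lin])
        also have "\<dots> \<le> (\<Sum>w\<in>Basis. norm v * b w)"
          using b z by (intro sum_norm_le) (auto intro!: mult_mono Basis_le_norm)
        finally show "norm (?D z v) \<le> (\<Sum>w\<in>Basis. b w) * norm v"
          by (simp add: sum_distrib_left mult.commute)
      qed
    qed
  qed
qed

text \<open>Every directional derivative is Lipschitz on the ball. Subtracting the derivative at
  \<open>a\<close> thus leaves a function whose derivative on the segment is at most a multiple of
  \<open>norm (b - a)\<close>, and the mean value inequality contributes the second factor. The
  constant does not depend on the base point \<open>a\<close>.\<close>

lemma C_on_2_Taylor:
  assumes V: "C_on (Suc (Suc 0)) V g" and sub: "cball a0 \<rho> \<subseteq> V"
  obtains K where "K \<ge> 0" "\<And>a b. a \<in> cball a0 \<rho> \<Longrightarrow> b \<in> cball a0 \<rho> \<Longrightarrow>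
    norm (g b - g a - frechet_derivative g (at a) (b - a)) \<le> K * (norm (b - a))\<^sup>2"
proof -
  let ?D = "\<lambda>x. frechet_derivative g (at x)"
  have d: "(g has_derivative ?D x) (at x)" if "x \<in> cball a0 \<rho>" for x
    using V that sub frechet_derivative_works by fastforce
  have "\<exists>k\<ge>0. \<forall>x\<in>cball a0 \<rho>. \<forall>y\<in>cball a0 \<rho>. norm (?D x w - ?D y w) \<le> k * norm (x - y)" for w
  proof -
    have "C_on (Suc 0) V (\<lambda>x. ?D x w)" using V by simp
    from C_on_1_Lipschitz[OF this sub] show ?thesis by metis
  qed
  then obtain k where k: "\<And>w. k w \<ge> 0" "\<And>w x y. x \<in> cball a0 \<rho> \<Longrightarrow> y \<in> cball a0 \<rho> \<Longrightarrow>
      norm (?D x w - ?D y w) \<le> k w * norm (x - y)"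
    by metis
  show ?thesis
  proof (rule that)
    show "(\<Sum>w\<in>Basis. k w) \<ge> 0" using k by (intro sum_nonneg) auto
    fix a b assume ab: "a \<in> cball a0 \<rho>" "b \<in> cball a0 \<rho>"
    have lin: "linear (?D z)" if "z \<in> cball a0 \<rho>" for z
      using d[OF that] has_derivative_linear by blast
    have seg: "closed_segment a b \<subseteq> cball a0 \<rho>"
      using ab by (simp add: closed_segment_subset)
    let ?h = "\<lambda>z. g z - ?D a z"
    have "norm (?h b - ?h a) \<le> ((\<Sum>w\<in>Basis. k w) * norm (b - a)) * norm (b - a)"
    proof (rule differentiable_bound[OF convex_closed_segment])
      fix z assume z: "z \<in> closed_segment a b"
      then have zc: "z \<in> cball a0 \<rho>" using seg by auto
      show "(?h has_derivative (\<lambda>v. ?D z v - ?D a v)) (at z within closed_segment a b)"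
        using lin[OF ab(1)]
        by (intro has_derivative_diff[OF has_derivative_at_withinI[OF d[OF zc]]]
            bounded_linear_imp_has_derivative) (simp add: linear_conv_bounded_linear)
      show "onorm (\<lambda>v. ?D z v - ?D a v) \<le> (\<Sum>w\<in>Basis. k w) * norm (b - a)"
      proof (rule onorm_le)
        fix v
        have "?D z v - ?D a v = ?D z (\<Sum>w\<in>Basis. (v \<bullet> w) *\<^sub>R w) - ?D a (\<Sum>w\<in>Basis. (v \<bullet> w) *\<^sub>R w)"
          by (simp add: euclidean_representation)
        also have "\<dots> = (\<Sum>w\<in>Basis. (v \<bullet> w) *\<^sub>R (?D z w - ?D a w))"
          by (simp only: linear_sum[OF lin[OF zc]] linear_sum[OF lin[OF ab(1)]]
              linear_scale[OF lin[OF zc]] linear_scale[OF lin[OF ab(1)]] scaleR_diff_right sum_subtractf)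
        also have "norm \<dots> \<le> (\<Sum>w\<in>Basis. norm v * (k w * norm (b - a)))"
        proof (rule sum_norm_le)
          fix w :: 'a assume w: "w \<in> Basis"
          have "norm (?D z w - ?D a w) \<le> k w * norm (z - a)" by (rule k(2)[OF zc ab(1)])
          also have "\<dots> \<le> k w * norm (b - a)"
            using k(1) dist_in_closed_segment(1)[OF z]
            by (intro mult_left_mono) (simp_all add: dist_norm norm_minus_commute)
          finally show "norm ((v \<bullet> w) *\<^sub>R (?D z w - ?D a w)) \<le> norm v * (k w * norm (b - a))"
            using mult_mono[OF Basis_le_norm[OF w, of v]] by simp
        qed
        finally show "norm (?D z v - ?D a v) \<le> (\<Sum>w\<in>Basis. k w) * norm (b - a) * norm v"
          by (simp add: mult_ac flip: sum_distrib_left sum_distrib_right)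
      qed
    qed auto
    moreover have "?h b - ?h a = g b - g a - ?D a (b - a)"
      by (simp add: linear_diff[OF lin[OF ab(1)]])
    ultimately show "norm (g b - g a - ?D a (b - a)) \<le> (\<Sum>w\<in>Basis. k w) * (norm (b - a))\<^sup>2"
      by (simp add: power2_eq_square mult.assoc)
  qed
qed

text \<open>Estimates are available chart by chart. A finite subcover and the smallest of its scales
  make them uniform, because they persist at smaller scales.\<close>

lemma compact_uniform_scale:
  fixes M :: "'a::metric_space set" and Q :: "'a \<Rightarrow> real \<Rightarrow> bool"
  assumes M: "compact M"
    and loc: "\<And>q0. q0 \<in> M \<Longrightarrow> \<exists>d>0. \<exists>e>0. \<forall>q\<in>M \<inter> ball q0 d. Q q e"
    and mono: "\<And>q e e'. Q q e \<Longrightarrow> 0 < e' \<Longrightarrow> e' \<le> e \<Longrightarrow> Q q e'"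
  shows "\<exists>e>0. \<forall>q\<in>M. Q q e"
proof -
  define P where "P q0 z \<longleftrightarrow> 0 < fst z \<and> 0 < snd z \<and> (\<forall>q\<in>M \<inter> ball q0 (fst z). Q q (snd z))"
    for q0 and z :: "real \<times> real"
  have ex: "\<exists>z. P q0 z" if q0: "q0 \<in> M" for q0
  proof -
    obtain d e where "d > 0" "e > 0" "\<forall>q\<in>M \<inter> ball q0 d. Q q e" using loc[OF q0] by blast
    then have "P q0 (d, e)" by (simp add: P_def)
    then show ?thesis by blast
  qed
  define d e where "d q = fst (SOME z. P q z)" and "e q = snd (SOME z. P q z)" for q
  have de: "0 < d q0" "0 < e q0" "\<And>q. q \<in> M \<Longrightarrow> q \<in> ball q0 (d q0) \<Longrightarrow> Q q (e q0)" if "q0 \<in> M" for q0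
    using someI_ex[OF ex[OF that]] unfolding P_def d_def e_def by blast+
  obtain C where C: "C \<subseteq> M" "finite C" "M \<subseteq> (\<Union>q\<in>C. ball q (d q))"
  proof (rule compactE_image[OF M, of M "\<lambda>q. ball q (d q)"])
    show "M \<subseteq> (\<Union>q\<in>M. ball q (d q))"
    proof
      fix q assume "q \<in> M"
      then show "q \<in> (\<Union>q\<in>M. ball q (d q))" using de(1) by (intro UN_I[of q]) simp_all
    qed
  qed simp_all
  \<comment> \<open>The inserted 1 keeps the minimum meaningful when \<open>C\<close> is
    empty.\<close>
  define m where "m = Min (insert 1 (e ` C))"
  have m: "0 < m" "\<And>q. q \<in> C \<Longrightarrow> m \<le> e q"
    using C(1,2) de(2) by (auto simp: m_def)
  have "Q q m" if qM: "q \<in> M" for q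
  proof -
    obtain q0 where q0: "q0 \<in> C" "q \<in> ball q0 (d q0)" using subsetD[OF C(3) qM] by blast
    then have "Q q (e q0)" using de(3)[OF _ qM] C(1) by blast
    then show ?thesis using m(1) m(2)[OF q0(1)] by (rule mono)
  qed
  with m(1) show ?thesis by blast
qed

subsection \<open>Reach and retraction\<close>

text \<open>A positive lower bound \<open>1 / \<kappa>\<close> for the reach of the manifold, in the form of Federer's
  characterization: the chord \<open>p - q\<close> is tangent at \<open>q\<close> up to second order, whereas \<open>x - q\<close> is
  normal at \<open>q\<close>.\<close>

lemma positive_reach:
  fixes M :: "'a::euclidean_space set"
  assumes M: "compact M" and sm: "smooth_submanifold m M"
  obtains \<kappa> where "\<kappa> > 0"
    "\<And>x p q. q \<in> M \<Longrightarrow> (\<And>p. p \<in> M \<Longrightarrow> dist x q \<le> dist x p) \<Longrightarrow> p \<in> M \<Longrightarrow>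
      (x - q) \<bullet> (p - q) \<le> \<kappa> * norm (x - q) * (norm (p - q))\<^sup>2"
proof -
  \<comment> \<open>The single parameter \<open>e\<close> is both the radius of validity and the
    reciprocal of the constant, so that decreasing it weakens the statement.\<close>
  define Q where "Q q e \<longleftrightarrow> (\<forall>x. (\<forall>p\<in>M. dist x q \<le> dist x p) \<longrightarrow>
      (\<forall>p\<in>M \<inter> ball q e. e * ((x - q) \<bullet> (p - q)) \<le> norm (x - q) * (norm (p - q))\<^sup>2))" for q e
  have "\<exists>d>0. \<exists>e>0. \<forall>q\<in>M \<inter> ball q0 d. Q q e" if q0: "q0 \<in> M" for q0
  proof -
    obtain U V \<phi> \<psi> B where q0U: "q0 \<in> U" and ch: "slice_chart m M U V \<phi> \<psi> B"
      using sm q0 by (auto simp: smooth_submanifold_def)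
    have U: "open U" and V: "open V" and hom: "homeomorphism U V \<phi> \<psi>" and s\<phi>: "smooth_on U \<phi>"
      and s\<psi>: "smooth_on V \<psi>" and im: "\<phi> ` (M \<inter> U) = V \<inter> span B"
      using ch by (auto simp: slice_chart_def)
    have \<psi>\<phi>: "\<psi> (\<phi> x) = x" if "x \<in> U" for x using hom that by (rule homeomorphism_apply1)
    have \<psi>M: "\<psi> y \<in> M" if "y \<in> V" "y \<in> span B" for y
    proof -
      have "y \<in> \<phi> ` (M \<inter> U)" unfolding im using that by simp
      then show ?thesis using \<psi>\<phi> by auto
    qed
    have "\<phi> q0 \<in> V" using hom q0U by (auto simp: homeomorphism_def)
    then obtain \<rho> where \<rho>: "\<rho> > 0" "cball (\<phi> q0) \<rho> \<subseteq> V"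
      using V open_contains_cball by blast
    obtain e1 where e1: "e1 > 0" "cball q0 e1 \<subseteq> U"
      using U q0U open_contains_cball by blast
    have C1: "C_on (Suc 0) U \<phi>" and C2: "C_on (Suc (Suc 0)) V \<psi>"
      using s\<phi> s\<psi> by (simp_all only: smooth_on_def)
    obtain L where L: "L \<ge> 0"
      "\<And>x y. x \<in> cball q0 e1 \<Longrightarrow> y \<in> cball q0 e1 \<Longrightarrow> norm (\<phi> x - \<phi> y) \<le> L * norm (x - y)"
      using C_on_1_Lipschitz[OF C1 e1(2)] by metis
    obtain K where K: "K \<ge> 0" "\<And>a b. a \<in> cball (\<phi> q0) \<rho> \<Longrightarrow> b \<in> cball (\<phi> q0) \<rho> \<Longrightarrow>
        norm (\<psi> b - \<psi> a - frechet_derivative \<psi> (at a) (b - a)) \<le> K * (norm (b - a))\<^sup>2"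
      using C_on_2_Taylor[OF C2 \<rho>(2)] by metis
    \<comment> \<open>Chosen so that \<phi> maps the ball of radius \<open>e2\<close> into the ball
      of radius \<rho> where the Taylor estimate holds; \<open>L + 1\<close> is positive even if
      \<open>L = 0\<close>.\<close>
    define e2 where "e2 = min e1 (\<rho> / (L + 1))"
    have e2: "0 < e2" "e2 \<le> e1" "(L + 1) * e2 \<le> \<rho>"
    proof -
      show "0 < e2" "e2 \<le> e1" using e1 \<rho> L by (auto simp: e2_def)
      have "e2 \<le> \<rho> / (L + 1)" by (simp add: e2_def)
      then show "(L + 1) * e2 \<le> \<rho>" using L(1) by (simp add: field_simps)
    qed
    have \<phi>c: "\<phi> p \<in> cball (\<phi> q0) \<rho>" if "p \<in> cball q0 e2" for p
    proof -
      have "norm (\<phi> q0 - \<phi> p) \<le> L * norm (q0 - p)"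
        using that e1 e2 by (intro L(2)) auto
      also have "\<dots> \<le> (L + 1) * e2"
        using that L(1) e2 by (intro mult_mono) (auto simp: dist_norm)
      finally show ?thesis using e2 by (simp add: dist_norm)
    qed
    \<comment> \<open>The first bound keeps \<open>p\<close> within \<open>e2\<close> of
      \<open>q0\<close>; the second absorbs the Taylor and Lipschitz constants.\<close>
    define e where "e = min (e2 / 2) (1 / (K * L\<^sup>2 + 1))"
    have e: "0 < e" "e \<le> e2 / 2" "e * (K * L\<^sup>2) \<le> 1"
    proof -
      have pos: "0 < K * L\<^sup>2 + 1" using K(1) by (simp add: add_nonneg_pos)
      show "0 < e" "e \<le> e2 / 2" using e2 pos by (auto simp: e_def)
      have "e \<le> 1 / (K * L\<^sup>2 + 1)" by (simp add: e_def)
      then have "e * (K * L\<^sup>2 + 1) \<le> 1" using pos by (simp add: field_simps)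
      with \<open>0 < e\<close> show "e * (K * L\<^sup>2) \<le> 1" by (simp add: algebra_simps)
    qed
    have "Q q e" if q: "q \<in> M \<inter> ball q0 (e2 / 2)" for q
      unfolding Q_def
    proof (intro allI impI ballI)
      fix x p assume near: "\<forall>p\<in>M. dist x q \<le> dist x p" and p: "p \<in> M \<inter> ball q e"
      define a b where "a = \<phi> q" and "b = \<phi> p"
      let ?D = "frechet_derivative \<psi> (at a)"
      have "dist q0 p < e2"
        using dist_triangle[of q0 p q] p q e by auto
      then have qc: "q \<in> cball q0 e2" and pc: "p \<in> cball q0 e2" using q e2 by auto
      have qU: "q \<in> U" and pU: "p \<in> U" using qc pc e1 e2 by auto
      have aV: "a \<in> V" "a \<in> span B" and bV: "b \<in> V" "b \<in> span B"
        using im p q qU pU by (auto simp: a_def b_def)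
      have D: "(\<psi> has_derivative ?D) (at a)"
        using C2 aV frechet_derivative_works by auto
      \<comment> \<open>The first-order condition at a nearest point: since \<open>b - a\<close>
        lies in \<open>span B\<close>, the curve \<open>\<psi> (?c t)\<close> stays in
        \<open>M\<close> for small \<open>t\<close>, and its squared distance to \<open>x\<close> is
        minimal at \<open>t = 0\<close>.\<close>
      have zero: "(x - q) \<bullet> ?D (b - a) = 0"
      proof -
        let ?c = "\<lambda>t. a + t *\<^sub>R (b - a)"
        have D': "(\<psi> has_derivative ?D) (at (?c 0))" using D by simp
        have dc: "(?c has_derivative (\<lambda>t. t *\<^sub>R (b - a))) (at 0)"
          by (auto intro!: derivative_eq_intros)
        have "((\<lambda>t. \<psi> (?c t)) has_derivative (\<lambda>t. ?D (t *\<^sub>R (b - a)))) (at 0)"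
          by (rule has_derivative_compose[OF dc D'])
        then have "((\<lambda>t. (x - \<psi> (?c t)) \<bullet> (x - \<psi> (?c t))) has_derivative
            (\<lambda>t. (x - \<psi> (?c 0)) \<bullet> (- ?D (t *\<^sub>R (b - a))) + (- ?D (t *\<^sub>R (b - a))) \<bullet> (x - \<psi> (?c 0)))) (at 0)"
          by (auto intro!: derivative_eq_intros)
        moreover have "(\<lambda>t. (x - \<psi> (?c 0)) \<bullet> (- ?D (t *\<^sub>R (b - a))) + (- ?D (t *\<^sub>R (b - a))) \<bullet> (x - \<psi> (?c 0)))
          = (*) (- 2 * ((x - q) \<bullet> ?D (b - a)))"
          using \<psi>\<phi>[OF qU] has_derivative_linear[OF D]
          by (auto simp: a_def linear_scale inner_commute fun_eq_iff)
        ultimately have "((\<lambda>t. (x - \<psi> (?c t)) \<bullet> (x - \<psi> (?c t))) has_field_derivative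
            - 2 * ((x - q) \<bullet> ?D (b - a))) (at 0)"
          by (simp add: has_field_derivative_def)
        moreover have "\<exists>d>0. \<forall>t. \<bar>0 - t\<bar> < d \<longrightarrow> (x - \<psi> (?c 0)) \<bullet> (x - \<psi> (?c 0)) \<le> (x - \<psi> (?c t)) \<bullet> (x - \<psi> (?c t))"
        proof -
          have "open (?c -` V)" using V by (intro open_vimage continuous_intros) auto
          moreover have "0 \<in> ?c -` V" using aV by simp
          ultimately obtain d where d: "d > 0" "ball 0 d \<subseteq> ?c -` V"
            using open_contains_ball by blast
          have "(x - \<psi> (?c 0)) \<bullet> (x - \<psi> (?c 0)) \<le> (x - \<psi> (?c t)) \<bullet> (x - \<psi> (?c t))" if "\<bar>0 - t\<bar> < d" for t
          proof -
            have "?c t \<in> V" using that d(2) by (auto simp: subset_iff)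
            moreover have "?c t \<in> span B"
              using aV bV by (intro span_add span_scale span_diff)
            ultimately have "dist x q \<le> dist x (\<psi> (?c t))" using near \<psi>M by blast
            then have "(dist x q)\<^sup>2 \<le> (dist x (\<psi> (?c t)))\<^sup>2" by (intro power_mono) auto
            then show ?thesis
              using \<psi>\<phi>[OF qU] by (simp add: a_def dist_norm power2_norm_eq_inner)
          qed
          with d(1) show ?thesis by blast
        qed
        ultimately have "- 2 * ((x - q) \<bullet> ?D (b - a)) = 0"
          using DERIV_local_min by blast
        then show ?thesis by simp
      qed
      have qp: "\<psi> a = q" "\<psi> b = p" using \<psi>\<phi> qU pU by (auto simp: a_def b_def)
      have "(x - q) \<bullet> (p - q) = (x - q) \<bullet> (p - q - ?D (b - a))"
        using zero by (simp add: inner_diff_right)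
      also have "\<dots> \<le> norm (x - q) * norm (p - q - ?D (b - a))"
        by (rule norm_cauchy_schwarz)
      also have "\<dots> \<le> norm (x - q) * (K * (norm (b - a))\<^sup>2)"
        using K(2)[of a b] \<phi>c qc pc qp by (intro mult_left_mono) (auto simp: a_def b_def)
      also have "\<dots> \<le> norm (x - q) * (K * (L * norm (p - q))\<^sup>2)"
        using L(2)[of p q] qc pc e2 K(1)
        by (intro mult_left_mono power_mono) (auto simp: a_def b_def)
      finally have "e * ((x - q) \<bullet> (p - q)) \<le> e * (norm (x - q) * (K * (L * norm (p - q))\<^sup>2))"
        using e(1) by (intro mult_left_mono) auto
      also have "\<dots> = (e * (K * L\<^sup>2)) * (norm (x - q) * (norm (p - q))\<^sup>2)"
        by (simp add: power_mult_distrib mult_ac)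
      also have "\<dots> \<le> 1 * (norm (x - q) * (norm (p - q))\<^sup>2)"
        using e(3) by (intro mult_right_mono) auto
      finally show "e * ((x - q) \<bullet> (p - q)) \<le> norm (x - q) * (norm (p - q))\<^sup>2" by simp
    qed
    with e e2 show ?thesis by (meson half_gt_zero)
  qed
  moreover have "Q q e'" if Q: "Q q e" and e': "0 < e'" "e' \<le> e" for q e e'
    unfolding Q_def
  proof (intro allI impI ballI)
    fix x p assume near: "\<forall>p\<in>M. dist x q \<le> dist x p" and p: "p \<in> M \<inter> ball q e'"
    have *: "e * ((x - q) \<bullet> (p - q)) \<le> norm (x - q) * (norm (p - q))\<^sup>2"
      using Q near p e' by (auto simp: Q_def)
    show "e' * ((x - q) \<bullet> (p - q)) \<le> norm (x - q) * (norm (p - q))\<^sup>2"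
    proof (cases "(x - q) \<bullet> (p - q) \<ge> 0")
      case True
      then have "e' * ((x - q) \<bullet> (p - q)) \<le> e * ((x - q) \<bullet> (p - q))"
        using e' by (intro mult_right_mono) auto
      with * show ?thesis by simp
    next
      case False
      then have "e' * ((x - q) \<bullet> (p - q)) \<le> 0" using e' by (simp add: mult_le_0_iff)
      also have "0 \<le> norm (x - q) * (norm (p - q))\<^sup>2" by simp
      finally show ?thesis .
    qed
  qed
  ultimately obtain e where e: "e > 0" "\<And>q. q \<in> M \<Longrightarrow> Q q e"
    using compact_uniform_scale[OF M, of Q] by blast
  show ?thesis
  proof (rule that[of "1 / e"])
    fix x p q assume q: "q \<in> M" and near: "\<And>p. p \<in> M \<Longrightarrow> dist x q \<le> dist x p" and p: "p \<in> M"
    have "e * ((x - q) \<bullet> (p - q)) \<le> norm (x - q) * (norm (p - q))\<^sup>2"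
    proof (cases "dist q p < e")
      case True
      then show ?thesis using e(2)[OF q] near p by (auto simp: Q_def)
    next
      case False
      then have "e \<le> norm (p - q)" by (simp add: dist_norm norm_minus_commute)
      \<comment> \<open>Away from \<open>q\<close> no tangency is involved: Cauchy-Schwarz suffices,
        as \<open>e\<close> can be replaced by the larger \<open>norm (p - q)\<close>.\<close>
      have "e * ((x - q) \<bullet> (p - q)) \<le> e * (norm (x - q) * norm (p - q))"
        using e(1) by (intro mult_left_mono norm_cauchy_schwarz) auto
      also have "\<dots> \<le> norm (p - q) * (norm (x - q) * norm (p - q))"
        using \<open>e \<le> norm (p - q)\<close> by (intro mult_right_mono) auto
      finally show ?thesis by (simp add: power2_eq_square mult_ac)
    qed
    with e(1) show "(x - q) \<bullet> (p - q) \<le> 1 / e * norm (x - q) * (norm (p - q))\<^sup>2"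
      by (simp add: field_simps)
  qed (use e in simp)
qed

lemma ball_union_homotopy_equivalent:
  fixes M :: "'a::euclidean_space set"
  assumes M: "compact M" "smooth_submanifold m M" and \<eta>: "\<eta> > 0"
  obtains r0 where "r0 > 0"
    "\<And>r P. 0 < r \<Longrightarrow> r \<le> r0 \<Longrightarrow> P \<subseteq> M \<Longrightarrow> M \<subseteq> ball_union P ((1 - \<eta>) * r) \<Longrightarrow>
      top_of_set (ball_union P r) homotopy_equivalent_space top_of_set M"
proof -
  obtain \<kappa> where \<kappa>: "\<kappa> > 0"
    "\<And>x p q. q \<in> M \<Longrightarrow> (\<And>p. p \<in> M \<Longrightarrow> dist x q \<le> dist x p) \<Longrightarrow> p \<in> M \<Longrightarrow>
      (x - q) \<bullet> (p - q) \<le> \<kappa> * norm (x - q) * (norm (p - q))\<^sup>2"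
    using positive_reach[OF M] by metis
  \<comment> \<open>The first bound makes the projection 2-Lipschitz. The second handles the part of
    a segment farther than \<open>\<eta> * r\<close> from \<open>M\<close>; its factor 4 comes from
    \<open>norm (p - q) \<le> 2 * r\<close> squared.\<close>
  define r0 where "r0 = min (1 / (4 * \<kappa>)) (\<eta> / (4 * \<kappa>))"
  show ?thesis
  proof (rule that)
    show "r0 > 0" using \<kappa> \<eta> by (simp add: r0_def)
    fix r P assume r: "0 < r" "r \<le> r0" and P: "P \<subseteq> M" and cov: "M \<subseteq> ball_union P ((1 - \<eta>) * r)"
    have \<kappa>r: "\<kappa> * r \<le> 1 / 4" "4 * \<kappa> * r \<le> \<eta>"
      using r(2) \<kappa>(1) by (auto simp: r0_def field_simps)
    define U where "U = ball_union P r"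
    define \<pi> where "\<pi> = closest_point M"
    have ne: "M \<noteq> {}" if "x \<in> U" for x
      using that P by (auto simp: U_def ball_union_def)
    have \<pi>M: "\<pi> x \<in> M" and \<pi>min: "\<And>p. p \<in> M \<Longrightarrow> dist x (\<pi> x) \<le> dist x p" if "x \<in> U" for x
      using closest_point_exists[OF compact_imp_closed[OF M(1)] ne[OF that], of x] by (auto simp: \<pi>_def)
    have near: "norm (x - \<pi> x) \<le> r" if "x \<in> U" for x
    proof -
      obtain p where p: "p \<in> P" "dist p x \<le> r" using \<open>x \<in> U\<close> by (auto simp: U_def ball_union_def)
      have "dist x (\<pi> x) \<le> dist x p" using p P by (intro \<pi>min[OF that]) auto
      with p show ?thesis by (simp add: dist_norm norm_minus_commute)
    qed
    have lip: "norm (\<pi> x - \<pi> y) \<le> 2 * norm (x - y)" if x: "x \<in> U" and y: "y \<in> U" for x y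
    proof -
      define a b where "a = \<pi> x" and "b = \<pi> y"
      have "(x - a) \<bullet> (b - a) \<le> \<kappa> * norm (x - a) * (norm (b - a))\<^sup>2"
        using \<pi>M \<pi>min x y unfolding a_def b_def by (intro \<kappa>(2)) auto
      also have "\<dots> \<le> \<kappa> * r * (norm (b - a))\<^sup>2"
        using near[OF x] \<kappa>(1) by (intro mult_right_mono mult_left_mono) (auto simp: a_def)
      also have "\<dots> \<le> 1 / 4 * (norm (b - a))\<^sup>2"
        using \<kappa>r by (intro mult_right_mono) auto
      finally have 1: "(x - a) \<bullet> (b - a) \<le> 1 / 4 * (norm (b - a))\<^sup>2" .
      have "(y - b) \<bullet> (a - b) \<le> \<kappa> * norm (y - b) * (norm (a - b))\<^sup>2"
        using \<pi>M \<pi>min x y unfolding a_def b_def by (intro \<kappa>(2)) auto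
      also have "\<dots> \<le> \<kappa> * r * (norm (a - b))\<^sup>2"
        using near[OF y] \<kappa>(1) by (intro mult_right_mono mult_left_mono) (auto simp: b_def)
      also have "\<dots> \<le> 1 / 4 * (norm (a - b))\<^sup>2"
        using \<kappa>r by (intro mult_right_mono) auto
      finally have 2: "(y - b) \<bullet> (a - b) \<le> 1 / 4 * (norm (b - a))\<^sup>2"
        by (simp add: norm_minus_commute)
      \<comment> \<open>The two reach estimates account for at most half of the left-hand side,
        which can be absorbed, and the last term is linear in \<open>norm (x - y)\<close>.\<close>
      have "(norm (b - a))\<^sup>2 = (x - a) \<bullet> (b - a) + (y - b) \<bullet> (a - b) - (x - y) \<bullet> (b - a)"
      proof -
        have "b - a = (x - a) - (y - b) - (x - y)" by simp
        then have "(norm (b - a))\<^sup>2 = ((x - a) - (y - b) - (x - y)) \<bullet> (b - a)"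
          by (simp only: power2_norm_eq_inner)
        moreover have "(y - b) \<bullet> (a - b) = - ((y - b) \<bullet> (b - a))"
          by (metis inner_minus_right minus_diff_eq)
        ultimately show ?thesis by (simp only: inner_diff_left)
      qed
      also have "\<dots> \<le> 1 / 2 * (norm (b - a))\<^sup>2 + norm (x - y) * norm (b - a)"
        using 1 2 norm_cauchy_schwarz[of "y - x" "b - a"]
        by (simp add: inner_diff_left norm_minus_commute)
      finally have "norm (b - a) * norm (b - a) \<le> 2 * norm (x - y) * norm (b - a)"
        by (simp add: power2_eq_square)
      then have "norm (b - a) \<le> 2 * norm (x - y)"
        by (cases "norm (b - a) = 0") (auto simp: mult_le_cancel_right)
      then show ?thesis by (simp add: a_def b_def norm_minus_commute)
    qed
    show "top_of_set (ball_union P r) homotopy_equivalent_space top_of_set M"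
      unfolding U_def[symmetric]
    proof (rule segment_retraction_homotopy_equivalent)
      show "continuous_on U \<pi>"
        by (rule lipschitz_on_continuous_on[of 2], rule lipschitz_onI) (use lip in \<open>auto simp: dist_norm\<close>)
      show "\<pi> ` U \<subseteq> M" using \<pi>M by auto
      have "(1 - \<eta>) * r \<le> r" using \<eta> r by simp
      then show "M \<subseteq> U"
        using cov by (force simp: U_def ball_union_def)
      show "\<pi> x = x" if "x \<in> M" for x
        using that by (simp add: \<pi>_def closest_point_self)
      fix x assume x: "x \<in> U"
      show "closed_segment (\<pi> x) x \<subseteq> U"
      proof
        fix y assume "y \<in> closed_segment (\<pi> x) x"
        then obtain u where u: "0 \<le> u" "u \<le> 1" and y: "y = (1 - u) *\<^sub>R \<pi> x + u *\<^sub>R x"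
          by (auto simp: closed_segment_def)
        define q s where "q = \<pi> x" and "s = norm (x - q)"
        have yq: "y - q = u *\<^sub>R (x - q)" and xy: "x - y = (1 - u) *\<^sub>R (x - q)"
          by (simp_all add: y q_def algebra_simps)
        show "y \<in> U"
        proof (cases "u * s \<le> \<eta> * r")
          case True
          obtain p where p: "p \<in> P" "dist p q \<le> (1 - \<eta>) * r"
            using cov \<pi>M[OF x] by (auto simp: q_def ball_union_def)
          have "dist p y \<le> dist p q + norm (y - q)"
            using dist_triangle[of p y q] by (simp add: dist_norm norm_minus_commute)
          also have "norm (y - q) = u * s" using u by (simp add: yq s_def)
          finally have "dist p y \<le> r" using p True by (simp add: algebra_simps)
          with p show ?thesis by (auto simp: U_def ball_union_def)
        next
          case False
          obtain p where p: "p \<in> P" "dist p x \<le> r" using x by (auto simp: U_def ball_union_def)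
          have "norm (p - q) \<le> norm (p - x) + norm (x - q)"
            using norm_triangle_ineq[of "p - x" "x - q"] by simp
          also have "\<dots> \<le> 2 * r" using p near[OF x] by (simp add: q_def dist_norm)
          finally have "(norm (p - q))\<^sup>2 \<le> (2 * r)\<^sup>2" by (intro power_mono) auto
          then have "\<kappa> * s * (norm (p - q))\<^sup>2 \<le> \<kappa> * s * (2 * r)\<^sup>2"
            using \<kappa>(1) by (intro mult_left_mono) (auto simp: s_def)
          moreover have "(x - q) \<bullet> (p - q) \<le> \<kappa> * s * (norm (p - q))\<^sup>2"
            using \<pi>M[OF x] \<pi>min[OF x] p P unfolding q_def s_def by (intro \<kappa>(2)) auto
          ultimately have 1: "(x - q) \<bullet> (p - q) \<le> s * (4 * \<kappa> * r * r)"
            by (simp add: power2_eq_square mult_ac)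
          have "4 * \<kappa> * r * r \<le> \<eta> * r" using \<kappa>r(2) r(1) by (intro mult_right_mono) auto
          then have "s * (4 * \<kappa> * r * r) \<le> s * (u * s)"
            using False by (intro mult_left_mono) (auto simp: s_def)
          with 1 have 2: "0 \<le> u * s\<^sup>2 - (x - q) \<bullet> (p - q)"
            by (simp add: power2_eq_square mult_ac)
          have yp: "y - p = u *\<^sub>R (x - q) - (p - q)" using yq by (simp add: algebra_simps)
          \<comment> \<open>Nonnegativity means that the triangle \<open>p\<close>,
            \<open>y\<close>, \<open>x\<close> has no acute angle at \<open>y\<close>, so
            \<open>y\<close> is no farther from \<open>p\<close> than \<open>x\<close> is.\<close>
          have "(x - y) \<bullet> (y - p) = (1 - u) * (u * s\<^sup>2 - (x - q) \<bullet> (p - q))"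
            by (simp only: xy yp inner_diff_right[of _ "u *\<^sub>R (x - q)" "p - q"] inner_scaleR_left
                inner_scaleR_right s_def power2_norm_eq_inner) (simp add: right_diff_distrib)
          also have "\<dots> \<ge> 0" using 2 u by simp
          finally have "0 \<le> (x - y) \<bullet> (y - p)" .
          moreover have "(norm (x - p))\<^sup>2 = (norm (y - p))\<^sup>2 + 2 * ((x - y) \<bullet> (y - p)) + (norm (x - y))\<^sup>2"
            using dot_norm[of "x - y" "y - p"] by simp
          ultimately have "(norm (y - p))\<^sup>2 \<le> (norm (x - p))\<^sup>2"
            using zero_le_power2[of "norm (x - y)"] by linarith
          then have "norm (y - p) \<le> norm (x - p)" by (rule power2_le_imp_le) simp
          with p(2) have "dist p y \<le> r" by (simp add: dist_norm norm_minus_commute)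
          with p(1) show ?thesis by (auto simp: U_def ball_union_def)
        qed
      qed
    qed
  qed
qed

subsection \<open>Volume of small balls\<close>

definition coordinate_projection :: "'a::euclidean_space set \<Rightarrow> 'a \<Rightarrow> 'a" where
  "coordinate_projection B x = (\<Sum>b\<in>B. (x \<bullet> b) *\<^sub>R b)"

lemma inner_sum_subset_Basis:
  assumes "B \<subseteq> Basis" "i \<in> Basis"
  shows "(\<Sum>b\<in>B. x b *\<^sub>R b) \<bullet> i = (if i \<in> B then x i else 0)"
proof -
  have "(\<Sum>b\<in>B. x b *\<^sub>R b) \<bullet> i = (\<Sum>b\<in>B. if b = i then x b else 0)"
    unfolding inner_sum_left using assms by (intro sum.cong) (auto simp: inner_Basis subset_iff)
  then show ?thesis using finite_subset[OF assms(1)] by simp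
qed

lemma norm_sum_subset_Basis:
  assumes "B \<subseteq> Basis"
  shows "norm (\<Sum>b\<in>B. x b *\<^sub>R b) = sqrt (\<Sum>b\<in>B. (x b)\<^sup>2)"
proof -
  let ?v = "\<Sum>b\<in>B. x b *\<^sub>R b"
  have "?v \<bullet> ?v = (\<Sum>i\<in>Basis. (?v \<bullet> i) * (?v \<bullet> i))" by (rule euclidean_inner)
  also have "\<dots> = (\<Sum>i\<in>Basis. if i \<in> B then (x i)\<^sup>2 else 0)"
    using assms by (intro sum.cong) (simp_all add: inner_sum_subset_Basis power2_eq_square)
  also have "\<dots> = (\<Sum>i\<in>B. (x i)\<^sup>2)"
    using assms by (simp add: sum.inter_restrict[symmetric] Int_absorb1)
  finally show ?thesis by (simp add: norm_eq_sqrt_inner)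
qed

lemma coordinate_projection:
  assumes B: "B \<subseteq> Basis"
  shows "linear (coordinate_projection B)" "coordinate_projection B x \<in> span B"
    and "y \<in> span B \<Longrightarrow> coordinate_projection B y = y"
proof -
  show "linear (coordinate_projection B)"
    unfolding coordinate_projection_def[abs_def]
    by (intro bounded_linear.linear bounded_linear_sum bounded_linear_scaleR_const
        bounded_linear_inner_left bounded_linear_ident)
  show "coordinate_projection B x \<in> span B"
    unfolding coordinate_projection_def by (rule span_sum, rule span_scale, rule span_base)
  assume "y \<in> span B"
  show "coordinate_projection B y = y"
  proof (rule euclidean_eqI)
    fix i :: 'a assume i: "i \<in> Basis"
    have "y \<bullet> i = (if i \<in> B then y \<bullet> i else 0)"
      using \<open>y \<in> span B\<close> i unfolding span_substd_basis[OF B] by simp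
    then show "coordinate_projection B y \<bullet> i = y \<bullet> i"
      unfolding coordinate_projection_def inner_sum_subset_Basis[OF B i] by (rule sym)
  qed
qed

text \<open>The derivative \<open>L\<close> of \<psi> maps \<open>span B\<close> isomorphically onto
  the tangent space, and \<open>f\<close> does the same isometrically. Precomposing \<psi> with the
  linear change of coordinates that turns \<open>L\<close> into \<open>f\<close> on
  \<open>span B\<close> gives the new chart.\<close>

lemma isometric_slice_chart:
  fixes M :: "'a::euclidean_space set"
  assumes ch: "slice_chart m M U V \<phi> \<psi> B" and q: "q \<in> M" "q \<in> U"
  obtains V' \<phi>' \<psi>' where "slice_chart m M U V' \<phi>' \<psi>' B" "\<phi>' q = 0"
    "\<And>v. v \<in> span B \<Longrightarrow> norm (frechet_derivative \<psi>' (at 0) v) = norm v"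
proof -
  have U: "open U" and V: "open V" and hom: "homeomorphism U V \<phi> \<psi>" and s\<phi>: "smooth_on U \<phi>"
    and s\<psi>: "smooth_on V \<psi>" and B: "B \<subseteq> Basis" and im: "\<phi> ` (M \<inter> U) = V \<inter> span B"
    using ch by (auto simp: slice_chart_def)
  define a where "a = \<phi> q"
  have a: "a \<in> V" "a \<in> span B" using im q by (auto simp: a_def)
  have \<psi>a: "\<psi> a = q" using homeomorphism_apply1[OF hom q(2)] by (simp add: a_def)
  define L L' where "L = frechet_derivative \<psi> (at a)" and "L' = frechet_derivative \<phi> (at q)"
  have C1: "C_on (Suc 0) U \<phi>" "C_on (Suc 0) V \<psi>"
    using s\<phi> s\<psi> by (simp_all only: smooth_on_def)
  have dL: "(\<psi> has_derivative L) (at a)"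
    using C1(2) a by (simp add: L_def flip: frechet_derivative_works)
  have dL': "(\<phi> has_derivative L') (at (\<psi> a))"
    using C1(1) q by (simp add: L'_def \<psi>a flip: frechet_derivative_works)
  have linL: "linear L" and linL': "linear L'" using dL dL' has_derivative_linear by blast+
  have L'L: "L' (L v) = v" for v
  proof -
    have "((\<lambda>y. \<phi> (\<psi> y)) has_derivative (\<lambda>v. L' (L v))) (at a)"
      by (rule has_derivative_compose[OF dL dL'])
    then have "((\<lambda>y. y) has_derivative (\<lambda>v. L' (L v))) (at a)"
      by (rule has_derivative_transform_within_open[OF _ V a(1)]) (rule homeomorphism_apply2[OF hom])
    from has_derivative_unique[OF this has_derivative_ident] show ?thesis by (simp add: fun_eq_iff)
  qed
  have inj: "inj L" using L'L by (metis injI)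
  have sub: "subspace (L ` span B)" using linL by (simp add: linear_subspace_image)
  have dim: "dim (span B) = dim (L ` span B)"
    using dim_image_eq[OF linL inj_on_subset[OF inj]] by simp
  obtain f g where f: "linear f" and g: "linear g" and f_im: "f ` span B = L ` span B"
    and g_im: "g ` (L ` span B) = span B" and nf: "\<And>x. x \<in> span B \<Longrightarrow> norm (f x) = norm x"
    and "\<And>x. x \<in> L ` span B \<Longrightarrow> norm (g x) = norm x"
    and gf: "\<And>x. x \<in> span B \<Longrightarrow> g (f x) = x" and fg: "\<And>x. x \<in> L ` span B \<Longrightarrow> f (g x) = x"
    by (rule isometries_subspaces[OF subspace_span sub dim]) blast
  define pr where "pr = coordinate_projection B"
  have pr: "linear pr" "\<And>x. pr x \<in> span B" "\<And>x. x \<in> span B \<Longrightarrow> pr x = x"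
    using coordinate_projection[OF B] by (simp_all add: pr_def)
  have LL': "L (L' y) = y" if "y \<in> L ` span B" for y using that L'L by auto
  have L'B: "L' y \<in> span B" if "y \<in> L ` span B" for y using that L'L by auto
  have fB: "f x \<in> L ` span B" if "x \<in> span B" for x using f_im that by auto
  have gB: "g (L x) \<in> span B" if "x \<in> span B" for x using g_im that by auto
  \<comment> \<open>On \<open>span B\<close> this is the inverse of \<open>L\<close> after
    \<open>f\<close>; on the remaining coordinate directions it is the identity, which makes it
    invertible on the whole space with inverse \<open>T\<close>.\<close>
  define S where "S x = L' (f (pr x)) + (x - pr x)" for x
  define T where "T x = g (L (pr x)) + (x - pr x)" for x
  have pr0: "pr (x - pr x) = 0" for x
    using pr by (simp add: linear_diff)
  have prS: "pr (S x) = L' (f (pr x))" for x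
    using pr0[of x] pr(3)[OF L'B[OF fB[OF pr(2)]]] by (simp add: S_def linear_add[OF pr(1)])
  have prT: "pr (T x) = g (L (pr x))" for x
    using pr0[of x] pr(3)[OF gB[OF pr(2)]] by (simp add: T_def linear_add[OF pr(1)])
  have S: "linear S"
    by (rule linearI) (simp_all add: S_def linear_add[OF linL'] linear_add[OF f] linear_add[OF pr(1)]
      linear_scale[OF linL'] linear_scale[OF f] linear_scale[OF pr(1)] scaleR_add_right scaleR_diff_right)
  have T: "linear T"
    by (rule linearI) (simp_all add: T_def linear_add[OF g] linear_add[OF linL] linear_add[OF pr(1)]
      linear_scale[OF g] linear_scale[OF linL] linear_scale[OF pr(1)] scaleR_add_right scaleR_diff_right)
  have TS: "T (S y) = y" for y
    unfolding T_def prS using LL'[OF fB[OF pr(2)]] gf[OF pr(2)] by (simp add: S_def)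
  have ST: "S (T y) = y" for y
    unfolding S_def prT using fg[OF imageI[OF pr(2)]] L'L by (simp add: T_def)
  have SB: "S x = L' (f x)" if "x \<in> span B" for x
    using pr(3)[OF that] by (simp add: S_def)
  have SB': "S ` span B \<subseteq> span B" using SB L'B fB by auto
  have TB': "T ` span B \<subseteq> span B" using pr(3) gB by (auto simp: T_def)
  show ?thesis
  proof (rule that[OF slice_chart_affine[OF ch S T TS ST SB' TB' a(2)]])
    show "T (\<phi> q - a) = 0" using linear_0[OF T] by (simp add: a_def)
    fix v assume v: "v \<in> span B"
    have "((\<lambda>y. S y + a) has_derivative S) (at 0)"
      using S by (intro has_derivative_add_const bounded_linear_imp_has_derivative)
        (simp add: linear_conv_bounded_linear)
    moreover have "(\<psi> has_derivative L) (at (S 0 + a))" using dL linear_0[OF S] by simp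
    ultimately have "((\<lambda>y. \<psi> (S y + a)) has_derivative (\<lambda>v. L (S v))) (at 0)"
      by (rule has_derivative_compose)
    from frechet_derivative_at[OF this]
    have "frechet_derivative (\<lambda>y. \<psi> (S y + a)) (at 0) v = L (S v)" by (metis)
    also have "\<dots> = f v" using SB[OF v] LL'[OF fB[OF v]] by simp
    finally show "norm (frechet_derivative (\<lambda>y. \<psi> (S y + a)) (at 0) v) = norm v"
      using nf[OF v] by simp
  qed
qed

text \<open>By polarization \<open>L\<close> preserves inner products on \<open>span B\<close>, so
  the Gram matrix is the identity and only the identity permutation contributes.\<close>

lemma gram_det_isometry:
  fixes L :: "'a::euclidean_space \<Rightarrow> 'a"
  assumes B: "B \<subseteq> Basis" and lin: "linear L" and iso: "\<And>v. v \<in> span B \<Longrightarrow> norm (L v) = norm v"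
  shows "gram_det B L = 1"
proof -
  have inner: "L b \<bullet> L c = (if b = c then 1 else 0)" if "b \<in> B" "c \<in> B" for b c
  proof -
    have bc: "b \<in> span B" "c \<in> span B" using that by (simp_all add: span_base)
    have "norm (L (b + c)) = norm (b + c)" "norm (L b) = norm b" "norm (L c) = norm c"
      by (rule iso[OF span_add[OF bc]], rule iso[OF bc(1)], rule iso[OF bc(2)])
    then have "L b \<bullet> L c = b \<bullet> c"
      by (simp only: dot_norm linear_add[OF lin, symmetric])
    also have "\<dots> = (if b = c then 1 else 0)" using that B by (intro inner_Basis) auto
    finally show ?thesis .
  qed
  have fin: "finite B" using B finite_Basis by (rule finite_subset)
  have "gram_det B L = (\<Sum>p | p permutes B. if p = id then 1 else 0)"
    unfolding gram_det_def
  proof (rule sum.cong[OF refl])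
    fix p assume "p \<in> {p. p permutes B}"
    then have p: "p permutes B" by simp
    show "of_int (sign p) * (\<Prod>b\<in>B. L b \<bullet> L (p b)) = (if p = id then 1 else (0::real))"
    proof (cases "p = id")
      case True
      then show ?thesis by (simp add: inner sign_id)
    next
      case False
      then obtain b where "p b \<noteq> b" by (auto simp: fun_eq_iff)
      moreover then have "b \<in> B" using p by (auto simp: permutes_def)
      ultimately have "\<exists>b\<in>B. L b \<bullet> L (p b) = 0"
        using inner permutes_in_image[OF p] by (intro bexI[of _ b]) auto
      then have "(\<Prod>b\<in>B. L b \<bullet> L (p b)) = 0" using fin by (rule prod_zero[rotated])
      with False show ?thesis by simp
    qed
  qed
  also have "\<dots> = 1" using fin by (simp add: finite_permutations permutes_id)
  finally show ?thesis .
qed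

lemma continuous_on_gram_det:
  assumes "\<And>b. b \<in> B \<Longrightarrow> continuous_on V (\<lambda>y. D y b)"
  shows "continuous_on V (\<lambda>y. gram_det B (D y))"
  unfolding gram_det_def using assms
  by (intro continuous_on_sum continuous_on_mult continuous_on_const continuous_on_prod continuous_on_inner)
     (auto simp: permutes_in_image)

lemma emeasure_lborel_span_ball:
  fixes B :: "'a::euclidean_space set"
  assumes B: "B \<subseteq> Basis" and t: "t > 0"
  shows "emeasure (lborel_span B) (span B \<inter> cball 0 t) = ennreal (unit_ball_vol (real (card B)) * t ^ card B)"
proof -
  have fin: "finite B" using B finite_Basis by (rule finite_subset)
  have meas: "(\<lambda>x. \<Sum>b\<in>B. x b *\<^sub>R b) \<in> measurable (\<Pi>\<^sub>M b\<in>B. lborel) borel"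
    by (intro borel_measurable_sum borel_measurable_scaleR borel_measurable_const)
       (auto intro!: measurable_component_singleton[THEN measurable_compose] simp: measurable_lborel1)
  have "span B \<inter> cball 0 t \<in> sets borel"
    by (intro sets.Int borel_closed) (auto simp: closed_subspace)
  then have "emeasure (lborel_span B) (span B \<inter> cball 0 t) =
      emeasure (\<Pi>\<^sub>M b\<in>B. lborel)
        ((\<lambda>x. \<Sum>b\<in>B. x b *\<^sub>R b) -` (span B \<inter> cball 0 t) \<inter> space (\<Pi>\<^sub>M b\<in>B. lborel))"
    unfolding lborel_span_def by (rule emeasure_distr[OF meas])
  also have "(\<lambda>x. \<Sum>b\<in>B. x b *\<^sub>R b) -` (span B \<inter> cball 0 t) = {x. sqrt (\<Sum>b\<in>B. (x b)\<^sup>2) \<le> t}"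
    by (auto simp: norm_sum_subset_Basis[OF B] intro: span_sum span_scale span_base)
  also have "emeasure (\<Pi>\<^sub>M b\<in>B. lborel) ({x. sqrt (\<Sum>b\<in>B. (x b)\<^sup>2) \<le> t} \<inter> space (\<Pi>\<^sub>M b\<in>B. lborel))
      = ennreal (unit_ball_vol (real (card B)) * t ^ card B)"
    by (rule emeasure_cball_aux[OF fin t])
  finally show ?thesis .
qed

text \<open>By continuity of the derivative, \<psi> minus its derivative at 0 is \<eta>-Lipschitz
  near 0. The derivative at 0 is isometric on \<open>span B\<close>, whence the restriction on
  \<open>x - y\<close>.\<close>

lemma near_isometry_neighbourhood:
  fixes \<psi> :: "'a::euclidean_space \<Rightarrow> 'a"
  assumes V: "open V" "0 \<in> V" and \<psi>: "C_on (Suc 0) V \<psi>" and B: "B \<subseteq> Basis"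
    and iso: "\<And>v. v \<in> span B \<Longrightarrow> norm (frechet_derivative \<psi> (at 0) v) = norm v"
    and \<eta>: "0 < \<eta>" "\<eta> < 1"
  obtains \<rho> where "\<rho> > 0" "cball 0 \<rho> \<subseteq> V"
    "\<And>y. y \<in> cball 0 \<rho> \<Longrightarrow> 1 - \<eta> \<le> sqrt (gram_det B (frechet_derivative \<psi> (at y)))"
    "\<And>x y. x \<in> cball 0 \<rho> \<Longrightarrow> y \<in> cball 0 \<rho> \<Longrightarrow> x - y \<in> span B \<Longrightarrow>
      norm (\<psi> x - \<psi> y) \<le> (1 + \<eta>) * norm (x - y)"
proof -
  let ?D = "\<lambda>y. frechet_derivative \<psi> (at y)"
  have dD: "(\<psi> has_derivative ?D y) (at y)" if "y \<in> V" for y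
    using \<psi> that frechet_derivative_works by auto
  have lin: "linear (?D y)" if "y \<in> V" for y using dD[OF that] has_derivative_linear by blast
  have cD: "continuous_on V (\<lambda>y. ?D y b)" for b using \<psi> by simp
  have ev_V: "\<forall>\<^sub>F y in nhds 0. y \<in> V" using V by (rule eventually_nhds_in_open)
  have lim: "((\<lambda>y. h y) \<longlongrightarrow> h 0) (nhds 0)" if "continuous_on V h" for h :: "'a \<Rightarrow> real"
    using that V by (simp add: continuous_on_eq_continuous_at isCont_def flip: tendsto_at_iff_tendsto_nhds)
  have "gram_det B (?D 0) = 1" by (rule gram_det_isometry[OF B lin[OF V(2)] iso])
  moreover have "(1 - \<eta>)\<^sup>2 < 1" using \<eta> by (simp add: power2_eq_square algebra_simps mult_strict_mono)
  ultimately have ev_gram: "\<forall>\<^sub>F y in nhds 0. (1 - \<eta>)\<^sup>2 < gram_det B (?D y)"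
    using order_tendstoD(1)[OF lim[OF continuous_on_gram_det[OF cD]]] by simp
  \<comment> \<open>This sum dominates the operator norm of the difference of derivatives, so
    continuity in each basis direction is enough.\<close>
  let ?s = "\<lambda>y. \<Sum>b\<in>Basis. norm (?D y b - ?D 0 b)"
  have "continuous_on V ?s"
    by (intro continuous_on_sum continuous_on_norm continuous_on_diff cD continuous_on_const)
  from order_tendstoD(2)[OF lim[OF this], of \<eta>]
  have ev_s: "\<forall>\<^sub>F y in nhds 0. ?s y < \<eta>" using \<eta> by simp
  have "\<forall>\<^sub>F y in nhds 0. y \<in> V \<and> (1 - \<eta>)\<^sup>2 < gram_det B (?D y) \<and> ?s y < \<eta>"
    using ev_V ev_gram ev_s by (intro eventually_conj)
  then obtain d where d: "d > 0"
    "\<And>y. dist y 0 < d \<Longrightarrow> y \<in> V \<and> (1 - \<eta>)\<^sup>2 < gram_det B (?D y) \<and> ?s y < \<eta>"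
    unfolding eventually_nhds_metric by blast
  have half: "y \<in> V" "(1 - \<eta>)\<^sup>2 < gram_det B (?D y)" "?s y < \<eta>" if "y \<in> cball 0 (d / 2)" for y
    using d(2)[of y] that d(1) by auto
  show ?thesis
  proof (rule that[of "d / 2"])
    show "d / 2 > 0" "cball 0 (d / 2) \<subseteq> V" using d(1) half(1) by auto
    show "1 - \<eta> \<le> sqrt (gram_det B (?D y))" if "y \<in> cball 0 (d / 2)" for y
      using half(2)[OF that] by (intro real_le_rsqrt) simp
    fix x y assume xy: "x \<in> cball 0 (d / 2)" "y \<in> cball 0 (d / 2)" and sp: "x - y \<in> span B"
    let ?h = "\<lambda>z. \<psi> z - ?D 0 z"
    have "norm (?h x - ?h y) \<le> \<eta> * norm (x - y)"
    proof (rule differentiable_bound[OF convex_cball _ _ xy])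
      fix z :: 'a assume z: "z \<in> cball 0 (d / 2)"
      show "(?h has_derivative (\<lambda>v. ?D z v - ?D 0 v)) (at z within cball 0 (d / 2))"
        using lin[OF V(2)]
        by (intro has_derivative_diff[OF has_derivative_at_withinI[OF dD[OF half(1)[OF z]]]]
            bounded_linear_imp_has_derivative) (simp add: linear_conv_bounded_linear)
      show "onorm (\<lambda>v. ?D z v - ?D 0 v) \<le> \<eta>"
      proof (rule onorm_le)
        fix v
        have "?D z v - ?D 0 v = ?D z (\<Sum>w\<in>Basis. (v \<bullet> w) *\<^sub>R w) - ?D 0 (\<Sum>w\<in>Basis. (v \<bullet> w) *\<^sub>R w)"
          by (simp add: euclidean_representation)
        also have "\<dots> = (\<Sum>w\<in>Basis. (v \<bullet> w) *\<^sub>R (?D z w - ?D 0 w))"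
          by (simp only: linear_sum[OF lin[OF half(1)[OF z]]] linear_sum[OF lin[OF V(2)]]
              linear_scale[OF lin[OF half(1)[OF z]]] linear_scale[OF lin[OF V(2)]]
              scaleR_diff_right sum_subtractf)
        also have "norm \<dots> \<le> (\<Sum>w\<in>Basis. norm v * norm (?D z w - ?D 0 w))"
          by (rule sum_norm_le) (simp add: mult_right_mono Basis_le_norm)
        also have "\<dots> = ?s z * norm v"
          by (simp add: mult.commute flip: sum_distrib_left)
        also have "\<dots> \<le> \<eta> * norm v"
          using half(3)[OF z] by (intro mult_right_mono) auto
        finally show "norm (?D z v - ?D 0 v) \<le> \<eta> * norm v" .
      qed
    qed
    moreover have "\<psi> x - \<psi> y = (?h x - ?h y) + ?D 0 (x - y)"
      by (simp add: linear_diff[OF lin[OF V(2)]])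
    ultimately show "norm (\<psi> x - \<psi> y) \<le> (1 + \<eta>) * norm (x - y)"
      using norm_triangle_ineq[of "?h x - ?h y" "?D 0 (x - y)"] iso[OF sp] by (simp add: algebra_simps)
  qed
qed

text \<open>A parametrization stretching lengths by at most \<open>1 + \<eta>\<close> maps a flat
  ball of radius \<open>s / (1 + \<eta>)\<close> into \<open>cball q s\<close>, and there the volume
  density is at least \<open>1 - \<eta>\<close>.\<close>

lemma volume_ball_lower_bound:
  fixes M :: "'a::euclidean_space set"
  assumes M: "compact M" and sm: "smooth_submanifold m M" and vol: "riemannian_volume m M vol"
    and \<eta>: "0 < \<eta>" "\<eta> < 1"
  obtains e where "e > 0"
    "\<And>q s. q \<in> M \<Longrightarrow> 0 < s \<Longrightarrow> s \<le> e \<Longrightarrow>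
      ennreal ((1 - \<eta>) * (unit_ball_vol (real m) * (s / (1 + \<eta>)) ^ m)) \<le> emeasure vol (M \<inter> cball q s)"
proof -
  have sets_vol: "sets vol = sets (restrict_space borel M)"
    and vol_chart: "\<And>U V \<phi> \<psi> B A. slice_chart m M U V \<phi> \<psi> B \<Longrightarrow> A \<in> sets vol \<Longrightarrow> A \<subseteq> U \<Longrightarrow>
      emeasure vol A = (\<integral>\<^sup>+y\<in>V \<inter> \<psi> -` A. ennreal (sqrt (gram_det B (frechet_derivative \<psi> (at y)))) \<partial>lborel_span B)"
    using vol by (auto simp: riemannian_volume_def)
  have Mb: "M \<in> sets borel" using M by (simp add: borel_compact)
  have in_vol: "M \<inter> X \<in> sets vol" if "X \<in> sets borel" for X
    using that Mb by (simp add: sets_vol sets_restrict_space_iff)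
  define Q where "Q q e \<longleftrightarrow> (\<forall>s. 0 < s \<longrightarrow> s \<le> e \<longrightarrow>
      ennreal ((1 - \<eta>) * (unit_ball_vol (real m) * (s / (1 + \<eta>)) ^ m)) \<le> emeasure vol (M \<inter> cball q s))" for q e
  have "\<exists>d>0. \<exists>e>0. \<forall>q\<in>M \<inter> ball q0 d. Q q e" if q0: "q0 \<in> M" for q0
  proof -
    obtain U V \<phi> \<psi> B where q0U: "q0 \<in> U" and ch: "slice_chart m M U V \<phi> \<psi> B" and \<phi>q0: "\<phi> q0 = 0"
      and iso: "\<And>v. v \<in> span B \<Longrightarrow> norm (frechet_derivative \<psi> (at 0) v) = norm v"
    proof -
      obtain U V \<phi> \<psi> B where q0U: "q0 \<in> U" and ch: "slice_chart m M U V \<phi> \<psi> B"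
        using sm q0 by (auto simp: smooth_submanifold_def)
      show thesis
        by (rule isometric_slice_chart[OF ch q0 q0U]) (rule that[OF q0U])
    qed
    have U: "open U" and V: "open V" and hom: "homeomorphism U V \<phi> \<psi>" and s\<psi>: "smooth_on V \<psi>"
      and B: "B \<subseteq> Basis" "card B = m" and im: "\<phi> ` (M \<inter> U) = V \<inter> span B"
      using ch by (auto simp: slice_chart_def)
    have "0 \<in> \<phi> ` (M \<inter> U)" using q0 q0U \<phi>q0 by force
    then have V0: "0 \<in> V" using im by simp
    have C1: "C_on (Suc 0) V \<psi>" using s\<psi> by (simp only: smooth_on_def)
    obtain \<rho> where \<rho>: "\<rho> > 0" "cball 0 \<rho> \<subseteq> V"
      and gram: "\<And>y. y \<in> cball 0 \<rho> \<Longrightarrow> 1 - \<eta> \<le> sqrt (gram_det B (frechet_derivative \<psi> (at y)))"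
      and lip: "\<And>x y. x \<in> cball 0 \<rho> \<Longrightarrow> y \<in> cball 0 \<rho> \<Longrightarrow> x - y \<in> span B \<Longrightarrow>
        norm (\<psi> x - \<psi> y) \<le> (1 + \<eta>) * norm (x - y)"
      by (rule near_isometry_neighbourhood[OF V V0 C1 B(1) _ \<eta>], rule iso, assumption) (rule that)
    have "continuous_on U \<phi>" using hom by (simp add: homeomorphism_def)
    then have "open (U \<inter> \<phi> -` ball 0 (\<rho> / 2))"
      using continuous_open_preimage[OF _ U open_ball] by blast
    moreover have "q0 \<in> U \<inter> \<phi> -` ball 0 (\<rho> / 2)" using q0U \<phi>q0 \<rho> by simp
    ultimately obtain d where d: "d > 0" "ball q0 d \<subseteq> U \<inter> \<phi> -` ball 0 (\<rho> / 2)"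
      using openE by blast
    have "Q q (\<rho> / 2)" if q: "q \<in> M \<inter> ball q0 d" for q
      unfolding Q_def
    proof (intro allI impI)
      fix s :: real assume s: "0 < s" "s \<le> \<rho> / 2"
      have qU: "q \<in> U" using q d(2) by blast
      define a where "a = \<phi> q"
      have a: "a \<in> V" "a \<in> span B" using im q qU by (auto simp: a_def)
      have a\<rho>: "norm a < \<rho> / 2" using q d(2) by (auto simp: a_def)
      have \<psi>a: "\<psi> a = q" unfolding a_def by (rule homeomorphism_apply1[OF hom qU])
      \<comment> \<open>For uniformity in \<open>q\<close>, the chart that is isometric at
        \<open>q0\<close> is merely translated to \<open>q\<close>. Allowing
        \<open>\<rho> / 2\<close> for the center and \<open>\<rho> / 2\<close> for the flat ball
        keeps everything in the region of the estimates.\<close>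
      let ?V = "(\<lambda>y. y + a) -` V"
      let ?\<psi> = "\<lambda>y. \<psi> (y + a)"
      have ch': "slice_chart m M U ?V (\<lambda>x. \<phi> x - a) ?\<psi> B"
        by (rule slice_chart_affine[OF ch linear_ident linear_ident _ _ _ _ a(2)]) auto
      \<comment> \<open>The volume formula speaks of subsets of the chart domain only; a lower bound
        survives the restriction to \<open>U\<close>.\<close>
      define A where "A = M \<inter> (cball q s \<inter> U)"
      have A: "A \<in> sets vol" "A \<subseteq> U"
        unfolding A_def using U by (auto intro!: in_vol)
      define t where "t = s / (1 + \<eta>)"
      have t: "0 < t" "(1 + \<eta>) * t = s" using s \<eta> by (auto simp: t_def)
      have ts: "t \<le> \<rho> / 2"
        using t s \<eta> by (smt (verit) mult_right_mono mult_cancel_right1)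
      let ?Z = "span B \<inter> cball 0 t"
      have Zb: "?Z \<in> sets borel"
        by (intro sets.Int borel_closed) (auto simp: closed_subspace)
      have Z\<rho>: "z + a \<in> cball 0 \<rho>" if "z \<in> ?Z" for z
        using that ts a\<rho> norm_triangle_ineq[of z a] by auto
      have ZA: "z \<in> ?V \<inter> ?\<psi> -` A" if z: "z \<in> ?Z" for z
      proof -
        have zV: "z + a \<in> V" using Z\<rho>[OF z] \<rho>(2) by blast
        have "z + a \<in> \<phi> ` (M \<inter> U)" unfolding im using zV z a by (auto intro: span_add)
        then have MU: "\<psi> (z + a) \<in> M \<inter> U" using homeomorphism_apply1[OF hom] by force
        have "norm (\<psi> (z + a) - \<psi> a) \<le> (1 + \<eta>) * norm z"
          using lip[OF Z\<rho>[OF z], of a] a\<rho> z \<rho>(1) by simp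
        also have "\<dots> \<le> (1 + \<eta>) * t" using z \<eta> by (intro mult_left_mono) auto
        finally have "\<psi> (z + a) \<in> cball q s" by (simp add: t(2) \<psi>a dist_norm norm_minus_commute)
        with MU zV show ?thesis by (simp add: A_def)
      qed
      have der: "frechet_derivative ?\<psi> (at z) = frechet_derivative \<psi> (at (z + a))" if "z \<in> ?Z" for z
      proof -
        have "z + a \<in> V" using Z\<rho>[OF that] \<rho>(2) by blast
        then have "(\<psi> has_derivative frechet_derivative \<psi> (at (z + a))) (at (z + a))"
          using C1 frechet_derivative_works by auto
        moreover have "((\<lambda>y. y + a) has_derivative (\<lambda>v. v)) (at z)"
          by (rule has_derivative_add_const[OF has_derivative_ident])
        ultimately have "(?\<psi> has_derivative (\<lambda>v. frechet_derivative \<psi> (at (z + a)) v)) (at z)"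
          by (rule has_derivative_compose[rotated])
        from frechet_derivative_at[OF this] show ?thesis by simp
      qed
      have "ennreal ((1 - \<eta>) * (unit_ball_vol (real m) * (s / (1 + \<eta>)) ^ m)) =
          ennreal (1 - \<eta>) * emeasure (lborel_span B) ?Z"
        unfolding emeasure_lborel_span_ball[OF B(1) t(1)] B(2) t_def[symmetric] using \<eta> t(1)
        by (intro ennreal_mult) auto
      also have "\<dots> = (\<integral>\<^sup>+y. ennreal (1 - \<eta>) * indicator ?Z y \<partial>lborel_span B)"
        using Zb by (subst nn_integral_cmult_indicator) (simp_all add: lborel_span_def)
      also have "\<dots> \<le> (\<integral>\<^sup>+y\<in>?V \<inter> ?\<psi> -` A. ennreal (sqrt (gram_det B (frechet_derivative ?\<psi> (at y)))) \<partial>lborel_span B)"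
      proof (rule nn_integral_mono)
        fix z
        show "ennreal (1 - \<eta>) * indicator ?Z z \<le>
            ennreal (sqrt (gram_det B (frechet_derivative ?\<psi> (at z)))) * indicator (?V \<inter> ?\<psi> -` A) z"
        proof (cases "z \<in> ?Z")
          case True
          with ZA[OF True] gram[OF Z\<rho>[OF True]] show ?thesis
            by (simp add: der[OF True] ennreal_leI)
        qed simp
      qed
      also have "\<dots> = emeasure vol A" by (rule vol_chart[OF ch' A, symmetric])
      also have "\<dots> \<le> emeasure vol (M \<inter> cball q s)"
        by (rule emeasure_mono) (auto simp: A_def intro!: in_vol)
      finally show "ennreal ((1 - \<eta>) * (unit_ball_vol (real m) * (s / (1 + \<eta>)) ^ m)) \<le> emeasure vol (M \<inter> cball q s)" .
    qed
    with d(1) \<rho>(1) show ?thesis by (meson half_gt_zero)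
  qed
  moreover have "Q q e'" if "Q q e" "0 < e'" "e' \<le> e" for q e e'
    using that by (simp add: Q_def)
  ultimately obtain e where "e > 0" "\<forall>q\<in>M. Q q e"
    using compact_uniform_scale[OF M, of Q] by blast
  then show ?thesis using that by (simp add: Q_def)
qed

subsection \<open>Coverage by the Poisson process\<close>

text \<open>The balls of radius \<open>\<delta> / 3\<close> around \<delta>-separated points are
  disjoint, so the total volume bounds the number of such points. The bound also ensures that a
  largest separated set exists, and it is a net because no point can be added.\<close>

lemma separated_net:
  fixes M :: "'a::metric_space set"
  assumes vol: "finite_measure vol" "space vol = M" "\<And>q s. M \<inter> cball q s \<in> sets vol"
    and c: "c > 0" "\<And>q s. q \<in> M \<Longrightarrow> 0 < s \<Longrightarrow> s \<le> e \<Longrightarrow> ennreal (c * s ^ m) \<le> emeasure vol (M \<inter> cball q s)"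
    and \<delta>: "0 < \<delta>" "\<delta> / 3 \<le> e"
  obtains S where "finite S" "S \<subseteq> M" "M \<subseteq> (\<Union>x\<in>S. cball x \<delta>)"
    "real (card S) * (c * (\<delta> / 3) ^ m) \<le> measure vol M"
proof -
  interpret finite_measure vol by (rule vol(1))
  define sep where "sep S \<longleftrightarrow> finite S \<and> S \<subseteq> M \<and> (\<forall>x\<in>S. \<forall>y\<in>S. x \<noteq> y \<longrightarrow> \<delta> < dist x y)" for S
  define v where "v = c * (\<delta> / 3) ^ m"
  have v: "0 < v" using c(1) \<delta>(1) by (simp add: v_def)
  have bound: "real (card S) * v \<le> measure vol M" if S: "sep S" for S
  proof -
    have fin: "finite S" and SM: "S \<subseteq> M" using S by (auto simp: sep_def)
    have disj: "disjoint_family_on (\<lambda>x. M \<inter> cball x (\<delta> / 3)) S"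
      unfolding disjoint_family_on_def
    proof (intro ballI impI equals0I)
      fix x y z assume xy: "x \<in> S" "y \<in> S" "x \<noteq> y"
        and z: "z \<in> (M \<inter> cball x (\<delta> / 3)) \<inter> (M \<inter> cball y (\<delta> / 3))"
      have "\<delta> < dist x y" using S xy by (auto simp: sep_def)
      also have "\<dots> \<le> dist x z + dist y z" by (rule dist_triangle2)
      also have "\<dots> \<le> \<delta> / 3 + \<delta> / 3" using z by (intro add_mono) auto
      finally show False using \<delta>(1) by simp
    qed
    have "real (card S) * v = (\<Sum>x\<in>S. v)" by simp
    also have "\<dots> \<le> (\<Sum>x\<in>S. measure vol (M \<inter> cball x (\<delta> / 3)))"
    proof (rule sum_mono)
      fix x assume "x \<in> S"
      then have "ennreal v \<le> emeasure vol (M \<inter> cball x (\<delta> / 3))"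
        unfolding v_def using SM \<delta> by (intro c(2)) auto
      then show "v \<le> measure vol (M \<inter> cball x (\<delta> / 3))"
        by (simp add: emeasure_eq_measure)
    qed
    also have "\<dots> = measure vol (\<Union>x\<in>S. M \<inter> cball x (\<delta> / 3))"
      using fin disj vol(3) by (intro finite_measure_finite_Union[symmetric]) auto
    also have "\<dots> \<le> measure vol M"
      using fin vol(2,3) sets.top[of vol] by (intro finite_measure_mono) auto
    finally show ?thesis .
  qed
  have le: "\<forall>S. sep S \<longrightarrow> card S < Suc (nat \<lfloor>measure vol M / v\<rfloor>)"
  proof (intro allI impI)
    fix S assume "sep S"
    then have "real (card S) \<le> measure vol M / v" using bound v by (simp add: field_simps)
    then show "card S < Suc (nat \<lfloor>measure vol M / v\<rfloor>)" by linarith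
  qed
  have "sep {}" by (simp add: sep_def)
  from ex_has_greatest_nat[of sep, OF this le]
  have "\<exists>S. sep S \<and> (\<forall>S'. sep S' \<longrightarrow> card S' \<le> card S)" .
  then obtain S where S: "sep S" "\<And>S'. sep S' \<Longrightarrow> card S' \<le> card S" by metis
  show ?thesis
  proof (rule that)
    show "finite S" "S \<subseteq> M" using S(1) by (auto simp: sep_def)
    show "real (card S) * (c * (\<delta> / 3) ^ m) \<le> measure vol M" using bound[OF S(1)] by (simp add: v_def)
    show "M \<subseteq> (\<Union>x\<in>S. cball x \<delta>)"
    proof
      fix y assume y: "y \<in> M"
      show "y \<in> (\<Union>x\<in>S. cball x \<delta>)"
      proof (rule ccontr)
        assume n: "y \<notin> (\<Union>x\<in>S. cball x \<delta>)"
        then have far: "\<And>x. x \<in> S \<Longrightarrow> \<delta> < dist x y" by auto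
        have "y \<notin> S" using n \<delta>(1) by fastforce
        moreover have "sep (insert y S)"
          using S(1) y far by (auto simp: sep_def dist_commute)
        ultimately show False using S(2)[of "insert y S"] S(1) by (auto simp: sep_def)
      qed
    qed
  qed
qed

text \<open>A Poisson count vanishes with probability \<open>exp\<close> of minus its mean, and the
  lower bound on \<open>f\<close> turns a lower bound on volume into one on this mean.\<close>

lemma poisson_void_probability_le:
  assumes pp: "poisson_process \<Omega> (density vol (\<lambda>x. ennreal (k * f x))) X"
    and f: "f \<in> borel_measurable vol" "\<And>x. x \<in> space vol \<Longrightarrow> c \<le> f x" and c: "0 \<le> c" "0 \<le> k"
    and A: "A \<in> sets vol" "ennreal v \<le> emeasure vol A" and v: "0 \<le> v"
  shows "measure \<Omega> {w \<in> space \<Omega>. points_in A (X w) = 0} \<le> exp (- (k * c * v))"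
proof -
  let ?\<mu> = "density vol (\<lambda>x. ennreal (k * f x))"
  have fin: "finite_measure ?\<mu>"
    and void: "measure \<Omega> {w \<in> space \<Omega>. points_in A (X w) = 0} = exp (- measure ?\<mu> A)"
    using pp A by (auto simp: poisson_process_def)
  have "ennreal (k * c * v) = ennreal (k * c) * ennreal v"
    using c v by (simp add: ennreal_mult)
  also have "\<dots> \<le> ennreal (k * c) * emeasure vol A" using A by (intro mult_left_mono) auto
  also have "\<dots> = (\<integral>\<^sup>+x. ennreal (k * c) * indicator A x \<partial>vol)"
    using A by (simp add: nn_integral_cmult_indicator)
  also have "\<dots> \<le> (\<integral>\<^sup>+x. ennreal (k * f x) * indicator A x \<partial>vol)"
    using f c by (intro nn_integral_mono mult_right_mono ennreal_leI mult_left_mono) auto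
  also have "\<dots> = emeasure ?\<mu> A"
    using f(1) A by (intro emeasure_density[symmetric]) auto
  finally have "k * c * v \<le> measure ?\<mu> A"
    using finite_measure.emeasure_eq_measure[OF fin] by simp
  then show ?thesis by (simp add: void)
qed

text \<open>The process counts Borel subsets of \<open>M\<close>, while rounding takes place in the
  ambient space. As all points lie in \<open>M\<close>, intersecting with \<open>M\<close> changes
  no count.\<close>

lemma poisson_points_in_measurable:
  fixes X :: "'w \<Rightarrow> 'a::topological_space multiset"
  assumes pp: "poisson_process \<Omega> \<mu> X" and \<mu>: "space \<mu> = M" "sets \<mu> = sets (restrict_space borel M)"
    and A: "A \<in> sets borel"
  shows "(\<lambda>w. points_in A (X w)) \<in> measurable \<Omega> (count_space UNIV)"
proof -
  have "A \<inter> M \<in> sets \<mu>" using A by (auto simp: \<mu>(2) sets_restrict_space)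
  then have "(\<lambda>w. points_in (A \<inter> M) (X w)) \<in> measurable \<Omega> (count_space UNIV)"
    using pp by (simp add: poisson_process_def)
  also have "?this \<longleftrightarrow> ?thesis"
  proof (rule measurable_cong)
    fix w assume "w \<in> space \<Omega>"
    then have "set_mset (X w) \<subseteq> M" using pp \<mu>(1) by (simp add: poisson_process_def)
    then show "points_in (A \<inter> M) (X w) = points_in A (X w)"
      unfolding points_in_def by (intro arg_cong[of _ _ size] filter_mset_cong) auto
  qed
  finally show ?thesis .
qed

text \<open>As \<eta> tends to 0 the product tends to \<open>c\<close>. Its factors are the losses:
  \<open>1 - \<eta>\<close> in the volume density, \<open>1 + \<eta>\<close> in lengths, and
  \<open>1 - 2 * \<eta>\<close> in the radius, half of it for the retraction and half for the
  net.\<close>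

lemma exists_margin:
  fixes c \<theta> :: real
  assumes "\<theta> < c"
  obtains \<eta> where "0 < \<eta>" "\<eta> < 1 / 2" "\<theta> < c * ((1 - \<eta>) * ((1 - 2 * \<eta>) / (1 + \<eta>)) ^ m)"
proof -
  have "((\<lambda>\<eta>. c * ((1 - \<eta>) * ((1 - 2 * \<eta>) / (1 + \<eta>)) ^ m)) \<longlongrightarrow>
      c * ((1 - 0) * ((1 - 2 * 0) / (1 + 0)) ^ m)) (at_right 0)"
    by (intro tendsto_intros) auto
  then have "\<forall>\<^sub>F \<eta> in at_right 0. \<theta> < c * ((1 - \<eta>) * ((1 - 2 * \<eta>) / (1 + \<eta>)) ^ m)"
    using assms by (intro order_tendstoD(1)) auto
  moreover have "\<forall>\<^sub>F \<eta> in at_right 0. (\<eta>::real) < 1 / 2"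
    by (intro eventually_at_rightI[of 0 "1 / 2"]) auto
  moreover have "\<forall>\<^sub>F \<eta> in at_right 0. (0::real) < \<eta>"
    by (rule eventually_at_right_less)
  ultimately have "\<forall>\<^sub>F \<eta> in at_right 0. 0 < \<eta> \<and> \<eta> < 1 / 2 \<and> \<theta> < c * ((1 - \<eta>) * ((1 - 2 * \<eta>) / (1 + \<eta>)) ^ m)"
    by eventually_elim simp
  then show ?thesis
    using eventually_happens'[OF trivial_limit_at_right_real] that by blast
qed

text \<open>The union bound over a net of mesh \<open>\<eta> * r n\<close>, which has \<open>O(r n ^ - m) = O(n)\<close> points, each of
  which has no point of the process nearby with probability at most \<open>n powr - a\<close>.\<close>

lemma homotopy_equivalent_whp:
  fixes M :: "'a::euclidean_space set" and P :: "nat \<Rightarrow> 'w \<Rightarrow> 'a multiset"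
  assumes M: "compact M" "smooth_submanifold m M" and vol: "riemannian_volume m M vol"
    and f: "f \<in> borel_measurable vol" "\<And>x. x \<in> M \<Longrightarrow> fmin \<le> f x" "fmin > 0"
    and f1: "(\<integral>\<^sup>+x. ennreal (f x) \<partial>vol) = 1"
    and \<Omega>: "prob_space \<Omega>"
    and P: "\<And>n. 1 \<le> n \<Longrightarrow> poisson_process \<Omega> (density vol (\<lambda>x. ennreal (real n * f x))) (P n)"
    and r: "\<And>n. 1 \<le> n \<Longrightarrow> 0 < r n" "r \<longlonglongrightarrow> 0"
    and C: "C > 0" "\<And>n. 1 \<le> n \<Longrightarrow> C * ln (real n) \<le> real n * r n ^ m"
    and \<theta>: "\<theta> < C * (unit_ball_vol (real m) * fmin)"
  obtains a K where "\<theta> < a"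
    "\<forall>\<^sub>F n in sequentially. \<exists>E\<in>sets \<Omega>. measure \<Omega> E \<le> K * real n powr (1 - a) \<and>
      (\<forall>w\<in>space \<Omega> - E. top_of_set (ball_union (set_mset (P n w)) (r n)) homotopy_equivalent_space top_of_set M)"
proof -
  interpret prob_space \<Omega> by (rule \<Omega>)
  have space_vol: "space vol = M" and sets_vol: "sets vol = sets (restrict_space borel M)"
    using vol by (auto simp: riemannian_volume_def)
  have Mb: "M \<in> sets borel" using M by (simp add: borel_compact)
  have ball_sets: "M \<inter> cball q s \<in> sets vol" for q s
    using Mb by (simp add: sets_vol sets_restrict_space_iff)
  \<comment> \<open>The density has total mass 1, so the volume is at most
    \<open>1 / fmin\<close>.\<close>
  have fin: "finite_measure vol"
  proof
    have "ennreal fmin * emeasure vol M = (\<integral>\<^sup>+x. ennreal fmin * indicator M x \<partial>vol)"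
      using sets.top[of vol] by (simp add: nn_integral_cmult_indicator space_vol)
    also have "\<dots> \<le> (\<integral>\<^sup>+x. ennreal (f x) \<partial>vol)"
      using f by (intro nn_integral_mono) (auto simp: space_vol ennreal_leI split: split_indicator)
    finally have "ennreal fmin * emeasure vol M \<le> 1" using f1 by simp
    then show "emeasure vol (space vol) \<noteq> \<infinity>"
      using f(3) by (auto simp: space_vol ennreal_mult_top top_unique)
  qed
  define \<omega> where "\<omega> = unit_ball_vol (real m)"
  have \<omega>: "\<omega> > 0" by (simp add: \<omega>_def)
  obtain \<eta> where \<eta>: "0 < \<eta>" "\<eta> < 1 / 2"
    and a: "\<theta> < C * (\<omega> * fmin) * ((1 - \<eta>) * ((1 - 2 * \<eta>) / (1 + \<eta>)) ^ m)"
    using exists_margin[OF \<theta>[folded \<omega>_def]] by blast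
  define a where "a = C * (\<omega> * fmin) * ((1 - \<eta>) * ((1 - 2 * \<eta>) / (1 + \<eta>)) ^ m)"
  define c where "c = (1 - \<eta>) * \<omega> / (1 + \<eta>) ^ m"
  have c: "c > 0" using \<eta> \<omega> by (simp add: c_def)
  obtain e where e: "e > 0" and "\<And>q s. q \<in> M \<Longrightarrow> 0 < s \<Longrightarrow> s \<le> e \<Longrightarrow>
      ennreal ((1 - \<eta>) * (unit_ball_vol (real m) * (s / (1 + \<eta>)) ^ m)) \<le> emeasure vol (M \<inter> cball q s)"
    using volume_ball_lower_bound[OF M vol, of \<eta>] \<eta> by auto
  then have vol_ball: "ennreal (c * s ^ m) \<le> emeasure vol (M \<inter> cball q s)" if "q \<in> M" "0 < s" "s \<le> e" for q s
    using that by (simp add: c_def \<omega>_def power_divide mult.assoc)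
  obtain r0 where r0: "r0 > 0" "\<And>r P. 0 < r \<Longrightarrow> r \<le> r0 \<Longrightarrow> P \<subseteq> M \<Longrightarrow> M \<subseteq> ball_union P ((1 - \<eta>) * r) \<Longrightarrow>
      top_of_set (ball_union P r) homotopy_equivalent_space top_of_set M"
    using ball_union_homotopy_equivalent[OF M \<eta>(1)] by blast
  define K where "K = measure vol M * (3 / \<eta>) ^ m / (c * C)"
  show ?thesis
  proof (rule that)
    show "\<theta> < a" using a by (simp add: a_def)
    have "\<forall>\<^sub>F n in sequentially. r n < min r0 e"
      by (rule order_tendstoD(2)[OF r(2)]) (use r0(1) e in simp)
    then show "\<forall>\<^sub>F n in sequentially. \<exists>E\<in>sets \<Omega>. measure \<Omega> E \<le> K * real n powr (1 - a) \<and>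
      (\<forall>w\<in>space \<Omega> - E. top_of_set (ball_union (set_mset (P n w)) (r n)) homotopy_equivalent_space top_of_set M)"
      using eventually_ge_at_top[of 3]
    proof eventually_elim
      case (elim n)
      then have n: "3 \<le> n" and rn: "0 < r n" "r n \<le> r0" "r n \<le> e" using r(1)[of n] by auto
      let ?\<mu> = "density vol (\<lambda>x. ennreal (real n * f x))"
      have pp: "poisson_process \<Omega> ?\<mu> (P n)" using n by (intro P) simp
      have "\<eta> * r n \<le> 1 * e" using rn \<eta> by (intro mult_mono) auto
      then have \<delta>_le: "\<eta> * r n / 3 \<le> e" using e by simp
      obtain S where S: "finite S" "S \<subseteq> M" "M \<subseteq> (\<Union>x\<in>S. cball x (\<eta> * r n))"
        and card: "real (card S) * (c * (\<eta> * r n / 3) ^ m) \<le> measure vol M"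
      proof (rule separated_net[OF fin space_vol ball_sets c, where e=e and m=m and \<delta>="\<eta> * r n"])
        fix q s assume "q \<in> M" "0 < s" "s \<le> e"
        then show "ennreal (c * s ^ m) \<le> emeasure vol (M \<inter> cball q s)" by (rule vol_ball)
      next
        show "0 < \<eta> * r n" using rn(1) \<eta>(1) by simp
        show "\<eta> * r n / 3 \<le> e" by (rule \<delta>_le)
      qed (rule that)
      \<comment> \<open>The covering radius \<open>(1 - \<eta>) * r n\<close> minus the mesh: a
        process point within \<open>s\<close> of a net point covers all points of \<open>M\<close>
        that this net point represents.\<close>
      define s where "s = (1 - 2 * \<eta>) * r n"
      have "s \<le> 1 * r n" unfolding s_def using \<eta> rn by (intro mult_right_mono) auto
      then have "s \<le> e" using rn(3) by linarith
      moreover have "0 < s" using \<eta> rn by (simp add: s_def)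
      ultimately have s: "0 < s" "s \<le> e" by simp_all
      \<comment> \<open>An explicit measurable set containing all bad outcomes, so the estimate does
        not presuppose that homotopy equivalence is itself an event.\<close>
      define E where "E = (\<Union>x\<in>S. {w \<in> space \<Omega>. points_in (M \<inter> cball x s) (P n w) = 0})"
      have void: "{w \<in> space \<Omega>. points_in (M \<inter> cball x s) (P n w) = 0} \<in> sets \<Omega>" for x
      proof -
        have "(\<lambda>w. points_in (M \<inter> cball x s) (P n w)) \<in> measurable \<Omega> (count_space UNIV)"
          using pp ball_sets by (simp add: poisson_process_def)
        from measurable_sets[OF this, of "{0}"] show ?thesis
          by (simp add: vimage_def Int_def conj_commute)
      qed
      have rm: "0 < r n ^ m" using rn by simp
      \<comment> \<open>From \<open>n = 3\<close> on the logarithm is at least 1, so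
        \<open>n * r n ^ m\<close> is at least \<open>C\<close>. This converts the net size, of
        order \<open>1 / r n ^ m\<close>, into \<open>K * n\<close>.\<close>
      have "C * 1 \<le> C * ln (real n)"
      proof (rule mult_left_mono)
        have "exp 1 \<le> real n" using exp_le n by linarith
        then show "1 \<le> ln (real n)" using n by (simp add: ln_ge_iff)
      qed (use C in simp)
      also have "\<dots> \<le> real n * r n ^ m" using n by (intro C(2)) simp
      finally have C1: "C \<le> real n * r n ^ m" by simp
      have "real (card S) * C * (c * (\<eta> / 3) ^ m) \<le> real (card S) * (real n * r n ^ m) * (c * (\<eta> / 3) ^ m)"
        using C1 c \<eta> by (intro mult_right_mono mult_left_mono) auto
      also have "\<dots> = real n * (real (card S) * (c * (\<eta> * r n / 3) ^ m))"
        by (simp add: power_mult_distrib power_divide)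
      also have "\<dots> \<le> real n * measure vol M" using card by (intro mult_left_mono) auto
      finally have "real (card S) \<le> real n * measure vol M / (C * (c * (\<eta> / 3) ^ m))"
        using C(1) c \<eta> by (simp add: pos_le_divide_eq mult.assoc)
      also have "\<dots> = K * real n" by (simp add: K_def power_divide mult_ac)
      finally have card': "real (card S) \<le> K * real n" .
      \<comment> \<open>\<open>a\<close> is defined to make this hold: the exponent in the void
        probability becomes \<open>a / C\<close> times \<open>n * r n ^ m\<close>, which is at least
        \<open>a * ln n\<close>.\<close>
      have "C * (c * s ^ m * fmin) = a * r n ^ m"
        by (simp add: a_def c_def s_def power_mult_distrib power_divide)
      then have exponent: "real n * fmin * (c * s ^ m) = a / C * (real n * r n ^ m)"
        using C(1) by (simp add: field_simps)
      have a0: "0 \<le> a" using C(1) \<omega> f(3) \<eta> by (simp add: a_def)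
      have "a * ln (real n) = a / C * (C * ln (real n))" using C(1) by simp
      also have "\<dots> \<le> a / C * (real n * r n ^ m)"
        using n a0 C by (intro mult_left_mono C(2)) auto
      finally have "exp (- (real n * fmin * (c * s ^ m))) \<le> exp (- (a * ln (real n)))"
        by (simp add: exponent)
      also have "\<dots> = real n powr - a" using n by (simp add: powr_def)
      finally have exp_le: "exp (- (real n * fmin * (c * s ^ m))) \<le> real n powr - a" .
      show ?case
      proof (intro bexI[of _ E] conjI ballI)
        show "E \<in> sets \<Omega>" unfolding E_def using S(1) void by (intro sets.finite_UN) auto
        have "measure \<Omega> E \<le> (\<Sum>x\<in>S. measure \<Omega> {w \<in> space \<Omega>. points_in (M \<inter> cball x s) (P n w) = 0})"
          unfolding E_def using S(1) void by (intro finite_measure_subadditive_finite) auto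
        also have "\<dots> \<le> (\<Sum>x\<in>S. real n powr - a)"
        proof (rule sum_mono)
          fix x assume "x \<in> S"
          then have "x \<in> M" using S(2) by auto
          have "measure \<Omega> {w \<in> space \<Omega>. points_in (M \<inter> cball x s) (P n w) = 0} \<le>
              exp (- (real n * fmin * (c * s ^ m)))"
            using f s c vol_ball[OF \<open>x \<in> M\<close> s] ball_sets
            by (intro poisson_void_probability_le[OF pp]) (auto simp: space_vol)
          with exp_le show "measure \<Omega> {w \<in> space \<Omega>. points_in (M \<inter> cball x s) (P n w) = 0} \<le> real n powr - a"
            by linarith
        qed
        also have "\<dots> = real (card S) * real n powr - a" by simp
        also have "\<dots> \<le> K * real n * real n powr - a" using card' by (intro mult_right_mono) auto
        also have "\<dots> = K * real n powr (1 - a)"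
          using n by (simp add: powr_diff powr_minus field_simps)
        finally show "measure \<Omega> E \<le> K * real n powr (1 - a)" .
        fix w assume w: "w \<in> space \<Omega> - E"
        have PM: "set_mset (P n w) \<subseteq> M"
          using pp w by (simp add: poisson_process_def space_vol)
        have "M \<subseteq> ball_union (set_mset (P n w)) ((1 - \<eta>) * r n)"
        proof
          fix y assume "y \<in> M"
          then obtain x where x: "x \<in> S" "dist x y \<le> \<eta> * r n" using S(3) by auto
          have "points_in (M \<inter> cball x s) (P n w) \<noteq> 0" using w x(1) by (auto simp: E_def)
          then have "filter_mset (\<lambda>p. p \<in> M \<inter> cball x s) (P n w) \<noteq> {#}"
            by (auto simp: points_in_def)
          then obtain p where "p \<in># filter_mset (\<lambda>p. p \<in> M \<inter> cball x s) (P n w)"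
            by (rule multiset_nonemptyE)
          then have p: "p \<in># P n w" "dist x p \<le> s" by auto
          have "dist p y \<le> dist x p + dist x y" by (rule dist_triangle3)
          also have "\<dots> \<le> (1 - \<eta>) * r n" using p(2) x(2) by (simp add: s_def algebra_simps)
          finally show "y \<in> ball_union (set_mset (P n w)) ((1 - \<eta>) * r n)"
            using p(1) by (auto simp: ball_union_def)
        qed
        then show "top_of_set (ball_union (set_mset (P n w)) (r n)) homotopy_equivalent_space top_of_set M"
          using rn PM by (intro r0(2)) auto
      qed
    qed
  qed
qed

section \<open>From exceptional sets to convergence in probability and to almost sure
  equality\<close>

theorem theorem4p9:
  fixes M :: "'a::euclidean_space set" and m :: nat and vol :: "'a measure"
    and f :: "'a \<Rightarrow> real" and fmin :: real
    and \<Omega> :: "'w measure" and P :: "nat \<Rightarrow> 'w \<Rightarrow> 'a multiset"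
    and r :: "nat \<Rightarrow> real" and C :: real
  assumes "m < DIM('a)"
    and "compact M" and "smooth_submanifold m M"
    and "riemannian_volume m M vol"
    and "f \<in> borel_measurable vol" and "bounded (f ` M)" and "\<forall>x\<in>M. 0 \<le> f x"
    and "(\<integral>\<^sup>+x. ennreal (f x) \<partial>vol) = 1"
    and "prob_space \<Omega>"
    and "\<forall>n\<ge>1. poisson_process \<Omega> (density vol (\<lambda>x. ennreal (real n * f x))) (P n)"
    and "fmin = (INF x\<in>M. f x)" and "fmin > 0"
    and "\<forall>n\<ge>1. r n > 0" and "r \<longlonglongrightarrow> 0"
    and "C > 0" and "\<forall>n\<ge>1. real n * r n ^ m \<ge> C * ln (real n)"
  shows
    "(C > 1 / (unit_ball_vol (real m) * fmin) \<longrightarrow>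
        (\<lambda>n. measure \<Omega> {w \<in> space \<Omega>.
            \<forall>k\<le>m. betti k (ball_union (set_mset (P n w)) (r n)) = betti k M}) \<longlonglongrightarrow> 1) \<and>
     (C > 2 / (unit_ball_vol (real m) * fmin) \<longrightarrow>
        (AE w in \<Omega>. \<exists>N>0. \<forall>n>N.
            \<forall>k\<le>m. betti k (ball_union (set_mset (P n w)) (r n)) = betti k M))"
proof -
  interpret prob_space \<Omega> by (rule assms(9))
  have vol: "space vol = M" "sets vol = sets (restrict_space borel M)"
    using assms(4) by (auto simp: riemannian_volume_def)
  have fmin: "fmin \<le> f x" if "x \<in> M" for x
    unfolding assms(11) using that assms(7) by (intro cINF_lower bdd_belowI2[of _ 0]) auto
  define \<omega> where "\<omega> = unit_ball_vol (real m)"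
  have \<omega>: "0 < \<omega> * fmin" using assms(12) by (simp add: \<omega>_def)
  define G where "G n = {w \<in> space \<Omega>.
      \<forall>k\<le>m. betti k (ball_union (set_mset (P n w)) (r n)) = betti k M}" for n
  \<comment> \<open>The index 0 is left out because nothing is assumed about
    \<open>P 0\<close>.\<close>
  have G_sets: "G n \<in> sets \<Omega>" if "1 \<le> n" for n
    unfolding G_def
  proof (rule sets_ball_union_homotopy_invariant[where Q="\<lambda>U. \<forall>k\<le>m. betti k U = betti k M"])
    show "(\<lambda>w. points_in A (P n w)) \<in> measurable \<Omega> (count_space UNIV)" if "A \<in> sets borel" for A
      using assms(10) \<open>1 \<le> n\<close> that vol
      by (intro poisson_points_in_measurable[of \<Omega> "density vol (\<lambda>x. ennreal (real n * f x))" "P n" M]) auto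
    show "\<forall>k\<le>m. betti k V = betti k M"
      if "top_of_set U homotopy_equivalent_space top_of_set V" "\<forall>k\<le>m. betti k U = betti k M" for U V :: "'a set"
      using that betti_homotopy_equivalent by metis
  qed
  have whp: "\<exists>a K. \<theta> < a \<and> (\<forall>\<^sub>F n in sequentially. \<exists>E\<in>sets \<Omega>.
      measure \<Omega> E \<le> K * real n powr (1 - a) \<and> space \<Omega> - E \<subseteq> G n)"
    if \<theta>: "\<theta> / (\<omega> * fmin) < C" for \<theta>
  proof -
    have "\<theta> < C * (\<omega> * fmin)" using \<theta> \<omega> by (simp add: pos_divide_less_eq)
    then obtain a K where aK: "\<theta> < a"
      "\<forall>\<^sub>F n in sequentially. \<exists>E\<in>sets \<Omega>. measure \<Omega> E \<le> K * real n powr (1 - a) \<and>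
        (\<forall>w\<in>space \<Omega> - E. top_of_set (ball_union (set_mset (P n w)) (r n)) homotopy_equivalent_space top_of_set M)"
      using homotopy_equivalent_whp[where f=f and fmin=fmin and r=r and C=C and \<theta>=\<theta>,
          OF assms(2-5) fmin assms(12,8,9)] assms(10,13-16) unfolding \<omega>_def by blast
    have "\<forall>\<^sub>F n in sequentially. \<exists>E\<in>sets \<Omega>. measure \<Omega> E \<le> K * real n powr (1 - a) \<and> space \<Omega> - E \<subseteq> G n"
      using aK(2)
    proof eventually_elim
      case (elim n)
      then show ?case
        using betti_homotopy_equivalent unfolding G_def by fast
    qed
    with aK(1) show ?thesis by blast
  qed
  show ?thesis
    unfolding \<omega>_def[symmetric] G_def[symmetric]
  proof (intro conjI impI)
    assume "1 / (\<omega> * fmin) < C"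
    then obtain a K where a: "1 < a" and ev: "\<forall>\<^sub>F n in sequentially. \<exists>E\<in>sets \<Omega>.
        measure \<Omega> E \<le> K * real n powr (1 - a) \<and> space \<Omega> - E \<subseteq> G n"
      using whp[of 1] by blast
    have "((\<lambda>n. real n powr (1 - a)) \<longlonglongrightarrow> 0)"
      using a by (intro tendsto_neg_powr filterlim_real_sequentially) auto
    then have "(\<lambda>n. 1 - K * real n powr (1 - a)) \<longlonglongrightarrow> 1 - K * 0"
      by (intro tendsto_intros)
    then have lim: "(\<lambda>n. 1 - K * real n powr (1 - a)) \<longlonglongrightarrow> 1" by simp
    show "(\<lambda>n. measure \<Omega> (G n)) \<longlonglongrightarrow> 1"
    proof (rule tendsto_sandwich[OF _ _ lim tendsto_const])
      show "\<forall>\<^sub>F n in sequentially. 1 - K * real n powr (1 - a) \<le> measure \<Omega> (G n)"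
        using ev eventually_ge_at_top[of 1]
      proof eventually_elim
        case (elim n)
        then obtain E where E: "E \<in> sets \<Omega>" "measure \<Omega> E \<le> K * real n powr (1 - a)" "space \<Omega> - E \<subseteq> G n"
          by blast
        have "1 - measure \<Omega> E = measure \<Omega> (space \<Omega> - E)" using prob_compl[OF E(1)] by simp
        also have "\<dots> \<le> measure \<Omega> (G n)" using E(3) G_sets elim(2) by (intro finite_measure_mono) auto
        finally show ?case using E(2) by simp
      qed
    qed simp
  next
    assume "2 / (\<omega> * fmin) < C"
    then obtain a K where a: "2 < a" and ev: "\<forall>\<^sub>F n in sequentially. \<exists>E\<in>sets \<Omega>.
        measure \<Omega> E \<le> K * real n powr (1 - a) \<and> space \<Omega> - E \<subseteq> G n"
      using whp[of 2] by blast
    then obtain N E where E: "\<And>n. N \<le> n \<Longrightarrow> E n \<in> sets \<Omega> \<and>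
        measure \<Omega> (E n) \<le> K * real n powr (1 - a) \<and> space \<Omega> - E n \<subseteq> G n"
      unfolding eventually_sequentially by metis
    \<comment> \<open>The empty set as default makes the family measurable at every index, as
      Borel-Cantelli requires, without affecting the tail.\<close>
    define F where "F n = (if N \<le> n then E n else {})" for n
    have F_sets: "F n \<in> sets \<Omega>" for n using E by (simp add: F_def)
    have "summable (\<lambda>n. K * real n powr (1 - a))"
      using a by (intro summable_mult) (simp add: summable_real_powr_iff)
    then have "summable (\<lambda>n. measure \<Omega> (F n))"
      by (rule summable_comparison_test_ev[rotated])
        (use E in \<open>auto simp: F_def eventually_sequentially intro!: exI[of _ N]\<close>)
    then have "AE w in \<Omega>. \<forall>\<^sub>F n in sequentially. w \<in> space \<Omega> - F n"
      by (intro borel_cantelli_AE1 F_sets) (simp_all add: emeasure_eq_measure)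
    then show "AE w in \<Omega>. \<exists>N>0. \<forall>n>N. \<forall>k\<le>m. betti k (ball_union (set_mset (P n w)) (r n)) = betti k M"
    proof (rule AE_mp, intro AE_I2 impI)
      fix w assume w: "w \<in> space \<Omega>" "\<forall>\<^sub>F n in sequentially. w \<in> space \<Omega> - F n"
      then obtain N' where N': "\<And>n. N' \<le> n \<Longrightarrow> w \<in> space \<Omega> - F n"
        unfolding eventually_sequentially by blast
      show "\<exists>N>0. \<forall>n>N. \<forall>k\<le>m. betti k (ball_union (set_mset (P n w)) (r n)) = betti k M"
      proof (intro exI[of _ "Suc (N + N')"] conjI allI impI)
        fix n k assume n: "Suc (N + N') < n" and k: "k \<le> m"
        have "w \<in> space \<Omega> - E n" using N'[of n] n by (simp add: F_def)
        then have "w \<in> G n" using E[of n] n by auto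
        with k show "betti k (ball_union (set_mset (P n w)) (r n)) = betti k M"
          by (simp add: G_def)
      qed simp
    qed
  qed
qed

end
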